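(* Let $f_{\ln 4}(x)=\dfrac{\mathcal{K}(\sqrt{x})}{\ln 4-\ln\sqrt{1-x}}$ and $g_{\ln 4}(x)=\dfrac{\ln 4-\ln\sqrt{1-x}}{\mathcal{K}(\sqrt{x})}$ for $0<x<1$, with normalized Taylor coefficients $a_n(\ln 4)$ and $b_n(\ln 4)$ at the origin, i.e. $f_{\ln 4}(x)=\frac{\pi}{2}\sum_{n\ge 0}a_n(\ln 4)x^n$ and $g_{\ln 4}(x)=\frac{2}{\pi}\sum_{n\ge 0}b_n(\ln 4)x^n$ near $x=0$. Then $$a_n(\ln 4)<0\quad\text{for all integers } n\geq 3,\qquad b_n(\ln 4)>0\quad\text{for all integers } n\geq 0.$$ Consequently, $$\left(-f_{\ln 4}'''\right)^{(m)}(x)>0,\qquad g_{\ln 4}^{(m)}(x)>0$$ for every integer $m\geq 0$ and every $x\in(0,1)$. In particular, $-f_{\ln 4}'''$ and $g_{\ln 4}$ are both absolutely monotonic on $(0,1)$.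
   Context: $\mathcal{K}(r)=\int_0^{\pi/2}\frac{\mathrm{d}t}{\sqrt{1-r^2\sin^2 t}}$ for $0<r<1$ is the complete elliptic integral of the first kind. With $W_n=\frac{\Gamma(n+\frac12)}{\Gamma(\frac12)\Gamma(n+1)}$ one has $\mathcal{K}(\sqrt{x})=\frac{\pi}{2}\sum_{n=0}^\infty W_n^2x^n$, and this power series (convergent for $|x|<1$) is used to regard $\mathcal{K}(\sqrt{x})$, and hence $f_{\ln 4}$ and $g_{\ln 4}=1/f_{\ln 4}$, as analytic functions in a neighborhood of $x=0$; the series defining $a_n(\ln 4)$ and $b_n(\ln 4)$ are their Taylor expansions at $0$. $\ln$ is the natural logarithm. A function $h$ is absolutely monotonic on an interval $I$ if it has derivatives of all orders on $I$ and $h^{(m)}(x)\ge 0$ for all $x\in I$ and all integers $m\ge 0$. *)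

theory Defs
  imports "HOL-Analysis.Analysis"
begin

definition ell_K :: "real \<Rightarrow> real" where
  "ell_K r = integral {0..pi/2} (\<lambda>t. 1 / sqrt (1 - r\<^sup>2 * (sin t)\<^sup>2))"

definition ell_W :: "nat \<Rightarrow> real" where
  "ell_W n = Gamma (real n + 1/2) / (Gamma (1/2) * Gamma (real n + 1))"

(* The analytic version, for -1 < x < 1, of x \<mapsto> K(sqrt x).  Substituting negative x into
   "ell_K (sqrt x)" would not give it: sqrt is odd in HOL, so that function is even in x. *)
definition ell_K_sqrt :: "real \<Rightarrow> real" where
  "ell_K_sqrt x = pi/2 * (\<Sum>n. (ell_W n)\<^sup>2 * x ^ n)"

definition ell_f :: "real \<Rightarrow> real \<Rightarrow> real" where
  "ell_f c x = ell_K (sqrt x) / (c - ln (sqrt (1 - x)))"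

definition ell_g :: "real \<Rightarrow> real \<Rightarrow> real" where
  "ell_g c x = (c - ln (sqrt (1 - x))) / ell_K (sqrt x)"

(* ell_f and ell_g, regarded as analytic functions in a neighbourhood of 0. *)
definition ell_f_an :: "real \<Rightarrow> real \<Rightarrow> real" where
  "ell_f_an c x = ell_K_sqrt x / (c - ln (sqrt (1 - x)))"

definition ell_g_an :: "real \<Rightarrow> real \<Rightarrow> real" where
  "ell_g_an c x = (c - ln (sqrt (1 - x))) / ell_K_sqrt x"

(* Taylor coefficients at 0, normalized by ell_f c x = pi/2 * (\<Sum>n. ell_a c n * x ^ n)
   and ell_g c x = 2/pi * (\<Sum>n. ell_b c n * x ^ n). *)
definition ell_a :: "real \<Rightarrow> nat \<Rightarrow> real" where
  "ell_a c n = 2/pi * ((deriv ^^ n) (ell_f_an c) 0 / fact n)"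

definition ell_b :: "real \<Rightarrow> nat \<Rightarrow> real" where
  "ell_b c n = pi/2 * ((deriv ^^ n) (ell_g_an c) 0 / fact n)"

(* D m is the m-th derivative of h on I; derivatives at endpoints belonging to I are one-sided. *)
definition absolutely_monotonic_on :: "real set \<Rightarrow> (real \<Rightarrow> real) \<Rightarrow> bool" where
  "absolutely_monotonic_on I h \<longleftrightarrow> is_interval I \<and>
     (\<exists>D :: nat \<Rightarrow> real \<Rightarrow> real.
        (\<forall>x\<in>I. D 0 x = h x) \<and>
        (\<forall>m. \<forall>x\<in>I. (D m has_real_derivative D (Suc m) x) (at x within I)) \<and>
        (\<forall>m. \<forall>x\<in>I. 0 \<le> D m x))"

end

theory Submission
  imports Defs "HOL-Complex_Analysis.Complex_Analysis"
begin

text \<open>Write \<open>A(z) = \<Sum>n. W\<^sub>n\<^sup>2 z\<^sup>n\<close>, so that \<open>K(sqrt x) = \<pi>/2 A(x)\<close>, and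
\<open>D(z) = ln 4 - 1/2 ln (1 - z)\<close>. Up to the normalising factors, the coefficients \<open>b\<^sub>n\<close> are those of
\<open>D/A\<close> and the \<open>a\<^sub>n\<close> are those of \<open>A/D\<close>. \<open>A\<close> and \<open>D\<close> continue to the plane cut along \<open>[1, \<infinity>)\<close>,
and the idea is to read the \<open>b\<^sub>n\<close> off the jump of \<open>D/A\<close> across the cut. On the cut that jump has the
sign of \<open>\<pi>/2 K(k')/K(k) - ln (4 k'/k)\<close> with \<open>k\<^sup>2 + k'\<^sup>2 = 1\<close>, which is positive; the number \<open>ln 4\<close> is what makes this
expression vanish in the limit \<open>k \<longrightarrow> 0\<close>.

To avoid boundary values on a slit plane, the cut plane is opened up by the Koebe map
\<open>z = 4w/(1+w)\<^sup>2\<close> of the unit disc. Landen's transformation \<open>A(4w/(1+w)\<^sup>2) = (1+w) A(w\<^sup>2)\<close> shows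
that \<open>D/A\<close> becomes the explicit function \<open>G(w) = (ln 4 + ln (1+w) - ln (1-w)) / ((1+w) A(w\<^sup>2))\<close>,
which is holomorphic in the disc because \<open>A\<close> has positive real part there. Lagrange's
coefficient extraction (\<open>koebe_lagrange\<close>) turns \<open>b\<^sub>n\<close> into a Taylor coefficient of
\<open>G(w) (1-w) (1+w)\<^sup>2\<^sup>n\<^sup>-\<^sup>1\<close>, that is, an integral over the circle of radius \<open>r < 1\<close>.
For \<open>n \<ge> 2\<close> the integrand is bounded, so \<open>r \<longrightarrow> 1\<close> is allowed. The boundary values of \<open>A\<close>
come from a Mehler-Dirichlet integral (\<open>ell_A_boundary\<close>):
\<open>2 e\<^sup>i\<^sup>t\<^sup>/\<^sup>2 A(e\<^sup>2\<^sup>i\<^sup>t) = A(cos\<^sup>2(t/2)) + i A(sin\<^sup>2(t/2))\<close>.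
The outcome (\<open>DA_coeff_moment\<close>) is \<open>\<pi> b\<^sub>n = \<integral> v(t) cos\<^sup>2\<^sup>n\<^sup>-\<^sup>2(t/2) dt\<close> over \<open>(0, \<pi>)\<close> with a
nonnegative density \<open>v\<close>. The sign of \<open>v\<close> is the inequality \<open>ell_A_ratio_gt_ln\<close>, which
Landen's transformation reduces to itself with a factor \<open>1/2\<close>.

Hence \<open>b\<^sub>2, b\<^sub>3, \<dots>\<close> is a decreasing and log-convex sequence, and it is positive because its
first terms are. Kaluza's theorem says that the reciprocal of a log-convex power series has negative
higher coefficients. Log-convexity fails here only at the triple \<open>b\<^sub>0, b\<^sub>1, b\<^sub>2\<close>, and only slightly,
which makes \<open>a\<^sub>2\<close> a tiny positive number; \<open>kaluza_variant\<close> shows that the term of \<open>a\<^sub>3\<close>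
absorbs it, so that \<open>a\<^sub>n < 0\<close> for \<open>n \<ge> 3\<close>. The coefficients are bounded, so both power series
represent the functions on \<open>(0, 1)\<close> and may be differentiated term by term.\<close>

section \<open>The coefficients \<open>W\<^sub>n\<close> and the hypergeometric series \<open>A\<close>\<close>

lemma ell_W_0 [simp]: "ell_W 0 = 1"
proof -
  have "Gamma (1/2::real) > 0" by (rule Gamma_real_pos) simp
  hence "Gamma (1/2::real) \<noteq> 0" by linarith
  thus ?thesis by (simp add: ell_W_def)
qed

lemma ell_W_Suc: "ell_W (Suc n) = ell_W n * (real (2 * n + 1) / real (2 * n + 2))"
proof -
  have 1: "Gamma (real (Suc n) + 1/2) = (real n + 1/2) * Gamma (real n + 1/2)"
    using Gamma_plus1[of "real n + 1/2"] nonpos_Ints_nonpos[of "real n + 1/2"]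
    by (force simp: add_ac)
  have 2: "Gamma (real (Suc n) + 1) = (real n + 1) * Gamma (real n + 1)"
    using Gamma_plus1[of "real n + 1"] nonpos_Ints_nonpos[of "real n + 1"]
    by (force simp: add_ac)
  have "Gamma (real n + 1) > 0" "Gamma (1/2::real) > 0"
    by (auto intro: Gamma_real_pos)
  thus ?thesis unfolding ell_W_def 1 2 by (simp add: field_simps)
qed

lemma ell_W_pos: "ell_W n > 0"
  by (induction n) (auto simp: ell_W_Suc)

lemma ell_W_le_1: "ell_W n \<le> 1"
proof (induction n)
  case (Suc n)
  have "ell_W n * (real (2 * n + 1) / real (2 * n + 2)) \<le> 1 * 1"
    using Suc ell_W_pos[of n] by (intro mult_mono) auto
  thus ?case by (simp add: ell_W_Suc)
qed auto

lemma ell_W_sq_le_1: "(ell_W n)\<^sup>2 \<le> 1"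
  using ell_W_le_1[of n] ell_W_pos[of n] by (simp add: power_le_one)

lemma ell_W_sq_le_quarter: "n \<ge> 1 \<Longrightarrow> (ell_W n)\<^sup>2 \<le> 1/4"
proof -
  assume "n \<ge> 1"
  hence "ell_W n \<le> 1/2"
  proof (induction n rule: dec_induct)
    case base show ?case by (simp add: ell_W_Suc)
  next
    case (step n)
    have "ell_W n * (real (2 * n + 1) / real (2 * n + 2)) \<le> (1/2) * 1"
      using step ell_W_pos[of n] by (intro mult_mono) auto
    thus ?case by (simp add: ell_W_Suc)
  qed
  hence "(ell_W n)\<^sup>2 \<le> (1/2)\<^sup>2" using ell_W_pos[of n] by (intro power_mono) auto
  thus ?thesis by (simp add: power2_eq_square)
qed

text \<open>Partial products of Wallis's product increase to \<open>\<pi>/2\<close>, and the \<open>n\<close>-th one is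
\<open>1 / (W\<^sub>n\<^sup>2 (2 n + 1))\<close>. The constant is sharp, and it has to be: it produces the coefficient \<open>1/2\<close> of
the logarithm in \<open>ell_A_complementary_ge_ln\<close>.\<close>
lemma ell_W_sq_ge: "(ell_W n)\<^sup>2 \<ge> 1 / (pi * (real n + 1/2))"
proof -
  define P where "P = (\<lambda>n. \<Prod>k=1..n. (4*real k^2) / (4*real k^2 - 1))"
  have P: "P n = 1 / ((ell_W n)\<^sup>2 * (2 * real n + 1))" for n
  proof (induction n)
    case (Suc n)
    have "P (Suc n) = P n * ((4*real (Suc n)^2) / (4*real (Suc n)^2 - 1))"
      by (simp add: P_def)
    also have "4*real (Suc n)^2 - 1 = (2 * real n + 1) * (2 * real n + 3)"
      by (simp add: algebra_simps power2_eq_square)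
    finally show ?case unfolding Suc using ell_W_pos[of n]
      by (simp add: ell_W_Suc divide_simps power2_eq_square) (simp add: algebra_simps)
  qed (simp add: P_def)
  have "incseq P"
  proof (rule incseq_SucI)
    fix n
    have "P n \<ge> 0" by (simp add: P)
    moreover have "(4*real (Suc n)^2) / (4*real (Suc n)^2 - 1) \<ge> 1"
      by (subst le_divide_eq_1_pos) (simp_all add: power2_eq_square algebra_simps add_pos_nonneg)
    ultimately have "P n * 1 \<le> P n * ((4*real (Suc n)^2) / (4*real (Suc n)^2 - 1))"
      by (intro mult_left_mono)
    thus "P n \<le> P (Suc n)" by (simp add: P_def)
  qed
  hence "P n \<le> pi / 2"
    using wallis unfolding P_def[symmetric] by (rule incseq_le)
  hence "1 \<le> pi / 2 * ((ell_W n)\<^sup>2 * (2 * real n + 1))"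
    using ell_W_pos[of n] by (simp add: P divide_le_eq)
  also have "\<dots> = (ell_W n)\<^sup>2 * (pi * (real n + 1/2))" by (simp add: algebra_simps)
  finally show ?thesis by (subst pos_divide_le_eq) (auto intro!: mult_pos_pos)
qed

lemma ell_W_gbinomial: "of_real (ell_W n) = (-1) ^ n * ((-1/2 :: complex) gchoose n)"
proof (induction n)
  case (Suc n)
  have "((-1/2 :: complex) gchoose Suc n) = (-1/2 gchoose n) * ((-1/2 - of_nat n) / of_nat (Suc n))"
    by (simp add: gbinomial_prod_rev)
  hence "(-1) ^ Suc n * ((-1/2 :: complex) gchoose Suc n) =
     ((-1) ^ n * (-1/2 gchoose n)) * (- ((-1/2 - of_nat n) / of_nat (Suc n)))"
    by (simp only: power_Suc mult_minus_left mult_minus_right mult_1_left mult_ac)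
  also have "- ((-1/2 - of_nat n) / of_nat (Suc n)) = ((1/2 + of_nat n) / of_nat (Suc n) :: complex)"
    by (simp add: field_simps del: of_nat_Suc)
  finally have "(-1) ^ Suc n * ((-1/2 :: complex) gchoose Suc n) =
     ((-1) ^ n * (-1/2 gchoose n)) * ((1/2 + of_nat n) / of_nat (Suc n))" .
  also have "\<dots> = of_real (ell_W n) * ((1/2 + of_nat n) / of_nat (Suc n))"
    by (simp only: Suc)
  also have "\<dots> = of_real (ell_W (Suc n))"
    unfolding ell_W_Suc of_real_mult
    by (simp add: divide_simps del: of_nat_Suc) (simp add: algebra_simps)
  finally show ?case ..
qed auto

lemma inv_sqrt_sums:
  assumes "norm z < 1"
  shows "(\<lambda>n. of_real (ell_W n) * z ^ n) sums ((1 - z) powr (-1/2 :: complex))"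
proof -
  have "(\<lambda>n. ((-1/2 :: complex) gchoose n) * (-z) ^ n) sums ((1 + (-z)) powr (-1/2))"
    by (rule gen_binomial_complex) (use assms in auto)
  thus ?thesis by (simp add: ell_W_gbinomial power_minus[of z] mult_ac)
qed

text \<open>Termwise integration of a uniformly convergent series by the Weierstrass test, in the form in which both
the sum function and the value of the integral are prescribed.\<close>
lemma has_integral_suminf:
  fixes f :: "nat \<Rightarrow> real \<Rightarrow> 'a::euclidean_space"
  assumes cont: "\<And>n. continuous_on {a..b} (f n)"
    and bound: "\<And>n x. x \<in> {a..b} \<Longrightarrow> norm (f n x) \<le> M n" and M: "summable M"
    and s: "\<And>x. x \<in> {a..b} \<Longrightarrow> (\<lambda>n. f n x) sums g x"
    and I: "\<And>n. (f n has_integral J n) {a..b}" "J sums j"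
  shows "(g has_integral j) {a..b}"
proof -
  have 1: "uniform_limit {a..b} (\<lambda>n x. \<Sum>k<n. f k x) (\<lambda>x. \<Sum>k. f k x) sequentially"
    by (rule Weierstrass_m_test) (use bound M in auto)
  have 2: "continuous_on {a..b} (\<lambda>x. \<Sum>k<n. f k x)" for n
    by (intro continuous_intros cont)
  obtain IJ J' where 3: "\<And>n. ((\<lambda>x. \<Sum>k<n. f k x) has_integral IJ n) {a..b}"
    "((\<lambda>x. \<Sum>k. f k x) has_integral J') {a..b}" "(IJ \<longlongrightarrow> J') sequentially"
    using uniform_limit_integral[OF 1 2] by auto
  have "IJ = (\<lambda>n. \<Sum>k<n. J k)"
    by (rule ext, rule has_integral_unique[OF 3(1)]) (intro has_integral_sum I, auto)
  hence "IJ \<longlonglongrightarrow> j" using I(2) by (simp add: sums_def)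
  hence "J' = j" using 3(3) LIMSEQ_unique by blast
  thus ?thesis
    using 3(2) s by (metis (no_types, lifting) has_integral_cong sums_unique)
qed

lemma wallis_integral: "((\<lambda>t. sin t ^ (2 * n)) has_integral (pi / 2 * ell_W n)) {0..pi/2}"
proof (induction n)
  case 0
  show ?case using has_integral_const_real[of "1::real" 0 "pi/2"] by simp
next
  case (Suc n)
  have "((\<lambda>t. real (2*n+1) * sin t ^ (2*n) - real (2*n+2) * sin t ^ (2*n+2)) has_integral
      (sin (pi/2) ^ (2*n+1) * cos (pi/2) - sin 0 ^ (2*n+1) * cos 0)) {0..pi/2}"
  proof (rule fundamental_theorem_of_calculus)
    fix x :: real
    have c: "cos x * cos x = 1 - sin x * sin x" by (metis cos_squared_eq power2_eq_square)
    have "((\<lambda>t. sin t ^ Suc (2*n) * cos t) has_real_derivative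
       ((1 + real (2*n)) * (cos x * sin x ^ (2*n)) * cos x + (- sin x) * sin x ^ Suc (2*n))) (at x)"
      by (intro DERIV_mult DERIV_power_Suc DERIV_sin DERIV_cos)
    hence "((\<lambda>t. sin t ^ (2*n+1) * cos t) has_real_derivative
       (real (2*n+1) * (cos x * sin x ^ (2*n)) * cos x - sin x ^ (2*n+1) * sin x)) (at x)"
      by (simp add: algebra_simps)
    also have "(real (2*n+1) * (cos x * sin x ^ (2*n)) * cos x - sin x ^ (2*n+1) * sin x)
       = real (2*n+1) * sin x ^ (2*n) * (cos x * cos x) - sin x ^ (2*n+2)"
      by simp
    also have "\<dots> = real (2*n+1) * sin x ^ (2*n) - real (2*n+2) * sin x ^ (2*n+2)"
      unfolding c by (simp add: algebra_simps)
    finally have "((\<lambda>t. sin t ^ (2*n+1) * cos t) has_real_derivative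
       real (2*n+1) * sin x ^ (2*n) - real (2*n+2) * sin x ^ (2*n+2)) (at x within {0..pi/2})"
      by (rule has_field_derivative_at_within)
    thus "((\<lambda>t. sin t ^ (2*n+1) * cos t) has_vector_derivative
       real (2*n+1) * sin x ^ (2*n) - real (2*n+2) * sin x ^ (2*n+2)) (at x within {0..pi/2})"
      by (simp only: has_real_derivative_iff_has_vector_derivative)
  qed auto
  hence A: "((\<lambda>t. real (2*n+1) * sin t ^ (2*n) - real (2*n+2) * sin t ^ (2*n+2)) has_integral 0) {0..pi/2}"
    by simp
  have B: "((\<lambda>t. real (2*n+1) * sin t ^ (2*n)) has_integral (real (2*n+1) * (pi/2 * ell_W n))) {0..pi/2}"
    by (intro has_integral_mult_right Suc)
  have "((\<lambda>t. real (2*n+2) * sin t ^ (2*n+2)) has_integral (real (2*n+1) * (pi/2 * ell_W n))) {0..pi/2}"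
    using has_integral_diff[OF B A] by simp
  from has_integral_mult_right[OF this, of "1 / real (2*n+2)"]
  have I: "((\<lambda>t. 1 / real (2*n+2) * (real (2*n+2) * sin t ^ (2*n+2))) has_integral
     1 / real (2*n+2) * (real (2*n+1) * (pi/2 * ell_W n))) {0..pi/2}" .
  have "1 / real (2*n+2) * (real (2*n+2) * sin t ^ (2*n+2)) = sin t ^ (2 * Suc n)" for t :: real
    by simp
  moreover have "1 / real (2*n+2) * (real (2*n+1) * (pi/2 * ell_W n)) = pi/2 * ell_W (Suc n)"
    unfolding ell_W_Suc by simp
  ultimately show ?case using I by (simp only:)
qed

text \<open>The hypergeometric function \<open>F(1/2, 1/2; 1; z)\<close>. It is polymorphic so that the same constant serves on the
real line and in the complex disc.\<close>
definition ell_A :: "'a \<Rightarrow> 'a::{real_normed_field,banach}" where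
  "ell_A z = (\<Sum>n. of_real ((ell_W n)\<^sup>2) * z ^ n)"

lemma ell_A_sums:
  fixes z :: "'a::{real_normed_field,banach}"
  assumes "norm z < 1"
  shows "(\<lambda>n. of_real ((ell_W n)\<^sup>2) * z ^ n) sums ell_A z"
proof -
  have "norm (of_real ((ell_W n)\<^sup>2) * z ^ n) \<le> 1 * norm z ^ n" for n
    unfolding norm_mult norm_power norm_of_real using ell_W_sq_le_1[of n]
    by (intro mult_right_mono) auto
  hence *: "norm (of_real ((ell_W n)\<^sup>2) * z ^ n) \<le> norm z ^ n" for n
    by simp
  have "summable (\<lambda>n. norm z ^ n)" using assms by simp
  hence "summable (\<lambda>n. of_real ((ell_W n)\<^sup>2) * z ^ n)"
    by (rule summable_comparison_test'[of _ 0]) (rule *)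
  thus ?thesis unfolding ell_A_def by (rule summable_sums)
qed

lemma ell_A_of_real: "\<bar>x\<bar> < 1 \<Longrightarrow> ell_A (of_real x) = (of_real (ell_A x) :: complex)"
proof -
  assume "\<bar>x\<bar> < 1"
  hence "(\<lambda>n. of_real ((ell_W n)\<^sup>2 * x ^ n) :: complex) sums of_real (ell_A x)"
    using ell_A_sums[of x] by (intro sums_of_real) auto
  thus ?thesis using ell_A_sums[of "of_real x :: complex"] \<open>\<bar>x\<bar> < 1\<close>
    by (auto simp: intro: sums_unique2)
qed

lemma ell_A_cnj: "norm z < 1 \<Longrightarrow> ell_A (cnj z) = cnj (ell_A z)"
proof -
  assume "norm z < 1"
  hence "(\<lambda>n. cnj (of_real ((ell_W n)\<^sup>2) * z ^ n)) sums cnj (ell_A z)"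
    using ell_A_sums[of z] by (subst sums_cnj)
  thus ?thesis using ell_A_sums[of "cnj z"] \<open>norm z < 1\<close>
    by (auto intro: sums_unique2)
qed

lemma ell_A_holomorphic: "ell_A holomorphic_on ball (0::complex) 1"
  by (rule power_series_holomorphic[where a = "\<lambda>n. of_real ((ell_W n)\<^sup>2)"])
     (use ell_A_sums in auto)

lemma ell_A_integral:
  fixes z :: complex
  assumes z: "norm z < 1"
  shows "((\<lambda>t. (1 - z * of_real (sin t ^ 2)) powr (-1/2)) has_integral (pi/2) * ell_A z) {0..pi/2}"
proof (rule has_integral_suminf)
  fix n
  show "continuous_on {0..pi/2} (\<lambda>t. of_real (ell_W n) * (z * of_real (sin t ^ 2)) ^ n)"
    by (intro continuous_intros)
  have "((\<lambda>t. of_real (ell_W n) * z ^ n * of_real (sin t ^ (2*n))) has_integral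
     (of_real (ell_W n) * z ^ n * of_real (pi/2 * ell_W n))) {0..pi/2}"
    by (intro has_integral_mult_right has_integral_of_real wallis_integral)
  thus "((\<lambda>t. of_real (ell_W n) * (z * of_real (sin t ^ 2)) ^ n) has_integral
     (of_real (pi/2) * (of_real ((ell_W n)\<^sup>2) * z ^ n))) {0..pi/2}"
    by (simp add: power_mult_distrib power_mult power2_eq_square mult_ac)
next
  fix n and x :: real
  have "norm z * sin x ^ 2 \<le> norm z * 1"
    by (intro mult_left_mono) (auto simp: power_le_one_iff abs_square_le_1)
  hence a: "norm (z * of_real (sin x ^ 2)) \<le> norm z" by (simp add: norm_mult norm_power)
  have "ell_W n * norm (z * of_real (sin x ^ 2)) ^ n \<le> 1 * norm z ^ n"
    using ell_W_le_1[of n] ell_W_pos[of n] a by (intro mult_mono power_mono) auto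
  thus "norm (of_real (ell_W n) * (z * of_real (sin x ^ 2)) ^ n) \<le> norm z ^ n"
    using ell_W_pos[of n] by (simp add: norm_mult norm_power)
  show "(\<lambda>n. of_real (ell_W n) * (z * of_real (sin x ^ 2)) ^ n) sums
     (1 - z * of_real (sin x ^ 2)) powr (-1/2)"
    by (rule inv_sqrt_sums) (use a z in auto)
next
  show "summable (\<lambda>n. norm z ^ n)" using z by auto
  show "(\<lambda>n. of_real (pi/2) * (of_real ((ell_W n)\<^sup>2) * z ^ n)) sums ((pi/2) * ell_A z)"
    by (intro sums_mult ell_A_sums z)
qed

text \<open>With \<open>v = u powr (-1/2)\<close> the hypothesis reads \<open>\<bar>1 - v\<^sup>2\<bar> < \<bar>v\<^sup>2\<bar>\<close>. This says that \<open>v\<^sup>2\<close> is nearer to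
\<open>1\<close> than to \<open>0\<close>, so \<open>Re (v\<^sup>2) > 1/2\<close>, and \<open>(Re v)\<^sup>2 \<ge> Re (v\<^sup>2)\<close>.\<close>
lemma Re_powr_minus_half_gt:
  fixes u :: complex
  assumes "norm (u - 1) < 1"
  shows "Re (u powr (-1/2)) > 1 / sqrt 2"
proof -
  define v where "v = u powr (-1/2)"
  have u0: "u \<noteq> 0" using assms by auto
  have Reu: "Re u > 0" using assms abs_Re_le_cmod[of "u - 1"] by simp
  have "Im (Ln u) > -pi/2 \<and> Im (Ln u) < pi/2"
    using Reu Re_Ln_pos_lt[of u] u0 by auto
  hence "cos (Im (Ln u) / 2) > 0" by (intro cos_gt_zero_pi) auto
  hence va: "Re v > 0" using u0 by (simp add: v_def powr_def Re_exp)
  have vv: "v * v = 1 / u"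
    unfolding v_def using u0 by (simp flip: powr_add add: powr_minus field_simps)
  have v0: "v \<noteq> 0" using va by auto
  have u: "u = 1 / (v * v)" using vv u0 by simp
  have "norm (1 - v * v) < norm (v * v)"
  proof -
    have "u - 1 = (1 - v * v) / (v * v)" using v0 by (simp add: u field_simps)
    hence "norm (1 - v * v) / norm (v * v) < 1" using assms by (simp add: norm_divide)
    thus ?thesis using v0 by (simp add: field_simps)
  qed
  hence "norm (1 - v * v) ^ 2 < norm (v * v) ^ 2" by (intro power_strict_mono) auto
  hence "Re v * Re v - Im v * Im v > 1/2"
    unfolding cmod_power2 by (simp add: power2_eq_square algebra_simps)
  hence "1/2 < Re v * Re v" using zero_le_square[of "Im v"] by linarith
  hence "(1 / sqrt 2)\<^sup>2 < (Re v)\<^sup>2"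
    by (simp add: power2_eq_square power_divide)
  hence "1 / sqrt 2 < Re v" by (rule power_less_imp_less_base) (use va in auto)
  thus ?thesis by (simp only: v_def)
qed

text \<open>The integrand of \<open>ell_A_integral\<close> satisfies this bound pointwise. It keeps \<open>A\<close> away from zero
uniformly on the whole disc, which gives both the holomorphy of \<open>D/A\<close> after the Koebe map and the domination
of the circle integrals.\<close>
lemma Re_ell_A_ge:
  fixes z :: complex
  assumes z: "norm z < 1"
  shows "Re (ell_A z) \<ge> 1 / sqrt 2"
proof -
  have I: "((\<lambda>t. Re ((1 - z * of_real (sin t ^ 2)) powr (-1/2))) has_integral
     Re ((pi/2) * ell_A z)) {0..pi/2}"
    using has_integral_linear[OF ell_A_integral[OF z] bounded_linear_Re] by (simp add: o_def)
  have c: "((\<lambda>t::real. 1 / sqrt 2) has_integral (pi/2) * (1 / sqrt 2)) {0..pi/2}"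
    using has_integral_const_real[of "1 / sqrt 2" 0 "pi/2"] by simp
  have "(pi/2) * (1 / sqrt 2) \<le> Re ((pi/2) * ell_A z)"
  proof (rule has_integral_le[OF c I])
    fix t :: real
    have "norm z * sin t ^ 2 \<le> norm z * 1"
      by (intro mult_left_mono) (auto simp: power_le_one_iff abs_square_le_1)
    hence "norm ((1 - z * of_real (sin t ^ 2)) - 1) < 1" using z by (simp add: norm_mult norm_power)
    from Re_powr_minus_half_gt[OF this]
    show "1 / sqrt 2 \<le> Re ((1 - z * of_real (sin t ^ 2)) powr (-1/2))" by simp
  qed
  also have "Re ((pi/2) * ell_A z) = (pi/2) * Re (ell_A z)" by simp
  finally show ?thesis using pi_gt_zero by (subst (asm) mult_le_cancel_left_pos) auto
qed

lemma ell_A_elliptic_integral: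
  assumes "0 \<le> x" "x < 1"
  shows "((\<lambda>t. 1 / sqrt (1 - x * (sin t)\<^sup>2)) has_integral (pi/2 * ell_A x)) {0..pi/2}"
proof -
  have "((\<lambda>t. Re ((1 - of_real x * of_real (sin t ^ 2)) powr (-1/2))) has_integral
     (pi/2 * ell_A x)) {0..pi/2}"
    using has_integral_linear[OF ell_A_integral[of "of_real x"] bounded_linear_Re] assms
    by (simp add: o_def ell_A_of_real)
  moreover have "Re ((1 - of_real x * of_real (sin t ^ 2)) powr (-1/2)) = 1 / sqrt (1 - x * (sin t)\<^sup>2)" for t
  proof -
    have "x * (sin t)\<^sup>2 \<le> x * 1" using assms
      by (intro mult_left_mono) (auto simp: power_le_one_iff abs_square_le_1)
    hence *: "1 - x * (sin t)\<^sup>2 > 0" using assms by simp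
    have "(1 - of_real x * of_real (sin t ^ 2)) powr (-1/2) = complex_of_real (1 - x * (sin t)\<^sup>2) powr of_real (-1/2)"
      by simp
    also have "\<dots> = of_real ((1 - x * (sin t)\<^sup>2) powr (-1/2))"
      by (rule powr_of_real) (use * in auto)
    finally show ?thesis using * by (simp only: Re_complex_of_real)
      (simp add: powr_minus powr_half_sqrt field_simps)
  qed
  ultimately show ?thesis by simp
qed

lemma ell_K_sqrt_eq: "0 \<le> x \<Longrightarrow> x < 1 \<Longrightarrow> ell_K (sqrt x) = pi/2 * ell_A x"
  unfolding ell_K_def using ell_A_elliptic_integral[of x] by (simp add: integral_unique)

section \<open>Parseval's identity and Landen's transformation\<close>

lemma has_integral_cis_int:
  "((\<lambda>t. cis (of_int k * t)) has_integral (if k = 0 then 2 * pi else 0)) {-pi..pi}"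
proof (cases "k = 0")
  case True
  thus ?thesis using has_integral_const_real[of "1::complex" "-pi" pi] by (simp add: scaleR_conv_of_real)
next
  case False
  have "((\<lambda>t. cis (of_int k * t)) has_integral
     (cis (of_int k * pi) / (\<i> * of_int k) - cis (of_int k * (-pi)) / (\<i> * of_int k))) {-pi..pi}"
  proof (rule fundamental_theorem_of_calculus)
    fix x :: real
    have "((\<lambda>z. exp (\<i> * of_int k * z) / (\<i> * of_int k)) has_field_derivative
       exp (\<i> * of_int k * of_real x)) (at (of_real x))"
      using False by (auto intro!: derivative_eq_intros)
    hence "((\<lambda>t. exp (\<i> * of_int k * of_real t) / (\<i> * of_int k)) has_vector_derivative
       exp (\<i> * of_int k * of_real x)) (at x within {-pi..pi})"
      by (rule has_vector_derivative_real_field)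
    thus "((\<lambda>t. cis (of_int k * t) / (\<i> * of_int k)) has_vector_derivative cis (of_int k * x))
       (at x within {-pi..pi})"
      by (simp add: cis_conv_exp mult_ac)
  qed auto
  moreover have "cis (of_int k * pi) = cis (of_int k * (-pi))"
    using sin_npi_int[of k] by (simp add: complex_eq_iff mult.commute)
  ultimately show ?thesis using False by simp
qed

text \<open>Folds an integral over a full circle to the upper half circle, where conjugate-symmetric functions
contribute twice their real part.\<close>
lemma has_integral_fold_symmetric:
  fixes F :: "real \<Rightarrow> 'a::banach"
  assumes "(F has_integral I) {-a..a}" "a \<ge> 0"
  shows "((\<lambda>x. F x + F (-x)) has_integral I) {0..a}"
proof -
  have i: "F integrable_on {-a..a}" using assms(1) by blast
  have "F integrable_on {0..a}" "F integrable_on {-a..0}"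
    using assms(2) by (auto intro: integrable_on_subinterval[OF i])
  hence 1: "(F has_integral (integral {0..a} F)) {0..a}" "(F has_integral (integral {-a..0} F)) {-a..0}"
    by blast+
  have "((\<lambda>x. F (-x)) has_integral (integral {-a..0} F)) {0..a}"
    using 1(2) has_integral_reflect_real[where f = F and a = "-a" and b = 0] by simp
  hence "((\<lambda>x. F x + F (-x)) has_integral (integral {0..a} F + integral {-a..0} F)) {0..a}"
    by (intro has_integral_add 1)
  moreover have "(F has_integral (integral {-a..0} F + integral {0..a} F)) {-a..a}"
    by (rule has_integral_combine[of "-a" 0 a]) (use 1 assms in auto)
  hence "integral {-a..0} F + integral {0..a} F = I" using assms(1) by (rule has_integral_unique)
  ultimately show ?thesis by (simp add: add.commute)
qed

lemma power_series_fourier_coeff: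
  fixes c :: "nat \<Rightarrow> complex"
  assumes H: "\<And>u. norm u < 1 \<Longrightarrow> (\<lambda>n. c n * u ^ n) sums H u" and w: "norm w < 1"
  shows "((\<lambda>t. H (w * cis t) * cis (- (real m * t))) has_integral (2 * pi * c m * w ^ m)) {-pi..pi}"
proof (rule has_integral_suminf)
  fix n
  show "continuous_on {-pi..pi} (\<lambda>t. c n * w ^ n * cis (of_int (int n - int m) * t))"
    by (intro continuous_intros)
  show "((\<lambda>t. c n * w ^ n * cis (of_int (int n - int m) * t)) has_integral
          (c n * w ^ n * (if int n - int m = 0 then 2 * pi else 0))) {-pi..pi}"
    by (intro has_integral_mult_right has_integral_cis_int)
next
  fix n and t :: real
  show "norm (c n * w ^ n * cis (of_int (int n - int m) * t)) \<le> norm (c n * w ^ n)"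
    by (simp add: norm_mult)
  have "(\<lambda>n. c n * (w * cis t) ^ n * cis (- (real m * t))) sums (H (w * cis t) * cis (- (real m * t)))"
    by (intro sums_mult2 H) (use w in \<open>auto simp: norm_mult\<close>)
  moreover have "c n * (w * cis t) ^ n * cis (- (real m * t)) =
     c n * w ^ n * cis (of_int (int n - int m) * t)" for n
    unfolding power_mult_distrib Complex.DeMoivre by (simp add: cis_mult algebra_simps)
  ultimately show "(\<lambda>n. c n * w ^ n * cis (of_int (int n - int m) * t)) sums
     (H (w * cis t) * cis (- (real m * t)))" by simp
next
  define s where "s = (1 + norm w) / 2"
  have s: "norm w < s" "s < 1" using w by (auto simp: s_def)
  have s0: "s \<ge> 0" using s(1) norm_ge_zero[of w] by linarith
  have "summable (\<lambda>n. c n * of_real s ^ n)"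
    using H[of "of_real s"] s s0 by (auto simp: sums_iff)
  thus "summable (\<lambda>n. norm (c n * w ^ n))"
    by (rule powser_insidea) (use s s0 in auto)
next
  have "(\<lambda>n. if n = m then c n * w ^ n * (2 * pi) else 0) sums (c m * w ^ m * (2 * pi))"
    by (rule sums_single)
  moreover have "(c n * w ^ n * (if int n - int m = 0 then 2 * pi else 0)) =
     (if n = m then c n * w ^ n * (2 * pi) else 0)" for n by auto
  ultimately show "(\<lambda>n. c n * w ^ n * (if int n - int m = 0 then 2 * pi else 0)) sums
     (2 * pi * c m * w ^ m)" by (simp add: mult_ac)
qed

text \<open>Parseval's identity for \<open>(1 + u) powr (-1/2) = \<Sum>n. (-1)\<^sup>n W\<^sub>n u\<^sup>n\<close>. For real
\<open>w\<close> the integrand is real, which leads to Landen's transformation; for \<open>w\<close> on the unit circle it has constant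
phase on either side of one singular angle, which separates the real and imaginary parts of the boundary value of \<open>A\<close>.\<close>
lemma ell_A_parseval:
  fixes w :: complex
  assumes w: "norm w < 1"
  shows "((\<lambda>t. (1 + w * cis t) powr (-1/2) * (1 + w * cis (-t)) powr (-1/2))
           has_integral (pi * ell_A (w\<^sup>2))) {0..pi}"
proof -
  define c where "c = (\<lambda>n. (-1) ^ n * complex_of_real (ell_W n))"
  define q where "q = (\<lambda>u::complex. (1 + u) powr (-1/2))"
  have q: "(\<lambda>n. c n * u ^ n) sums q u" if "norm u < 1" for u
    using inv_sqrt_sums[of "-u"] that by (simp add: c_def q_def power_minus[of u] mult_ac)
  have pos: "Re (1 + w * cis t) > 0" for t
  proof -
    have "\<bar>Re (w * cis t)\<bar> \<le> norm (w * cis t)" by (rule abs_Re_le_cmod)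
    thus ?thesis using w by (simp add: norm_mult)
  qed
  have nz: "1 + w * cis t \<noteq> 0" for t
    using pos[of t] by (metis less_irrefl zero_complex.simps(1))
  have cont: "continuous_on {-pi..pi} (\<lambda>t. q (w * cis t))"
    unfolding q_def
    by (intro continuous_on_powr_complex continuous_intros) (use pos nz in \<open>force intro: less_imp_le\<close>)+
  then obtain B where B: "\<And>t. t \<in> {-pi..pi} \<Longrightarrow> norm (q (w * cis t)) \<le> B"
    using compact_continuous_image[OF cont] by (force simp: bounded_iff dest: compact_imp_bounded)
  have "((\<lambda>t. q (w * cis t) * q (w * cis (-t))) has_integral (2 * pi * ell_A (w\<^sup>2))) {-pi..pi}"
  proof (rule has_integral_suminf)
    fix m
    show "continuous_on {-pi..pi} (\<lambda>t. (c m * w ^ m) * (q (w * cis t) * cis (- (real m * t))))"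
      by (intro continuous_intros cont)
    show "((\<lambda>t. (c m * w ^ m) * (q (w * cis t) * cis (- (real m * t)))) has_integral
       (c m * w ^ m) * (2 * pi * c m * w ^ m)) {-pi..pi}"
      by (intro has_integral_mult_right power_series_fourier_coeff q w)
  next
    fix m t assume t: "t \<in> {-pi..pi}"
    have "norm (c m) \<le> 1" using ell_W_le_1[of m] ell_W_pos[of m] by (simp add: c_def norm_mult norm_power)
    hence "norm (c m) * norm w ^ m * norm (q (w * cis t)) \<le> 1 * norm w ^ m * B"
      using B[OF t] by (intro mult_mono) (auto intro!: mult_nonneg_nonneg)
    thus "norm ((c m * w ^ m) * (q (w * cis t) * cis (- (real m * t)))) \<le> norm w ^ m * B"
      by (simp add: norm_mult norm_power mult_ac)
  next
    fix t :: real
    have "(\<lambda>m. q (w * cis t) * (c m * (w * cis (-t)) ^ m)) sums (q (w * cis t) * q (w * cis (-t)))"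
      by (intro sums_mult q) (use w in \<open>auto simp: norm_mult\<close>)
    moreover have "q (w * cis t) * (c m * (w * cis (-t)) ^ m) =
       (c m * w ^ m) * (q (w * cis t) * cis (- (real m * t)))" for m
      by (simp add: power_mult_distrib Complex.DeMoivre mult_ac)
    ultimately show "(\<lambda>m. (c m * w ^ m) * (q (w * cis t) * cis (- (real m * t)))) sums
       (q (w * cis t) * q (w * cis (-t)))" by simp
  next
    show "summable (\<lambda>m. norm w ^ m * B)" using w by (intro summable_mult2) auto
  next
    have "(\<lambda>m. 2 * pi * (of_real ((ell_W m)\<^sup>2) * (w\<^sup>2) ^ m)) sums (2 * pi * ell_A (w\<^sup>2))"
      by (intro sums_mult ell_A_sums) (use w in \<open>auto simp: norm_power power_less_one_iff\<close>)
    moreover have "c m * w ^ m * (2 * pi * c m * w ^ m) =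
       2 * pi * (of_real ((ell_W m)\<^sup>2) * (w\<^sup>2) ^ m)" for m
    proof -
      have "((-1::complex) ^ m * (-1) ^ m) = 1" by (simp flip: power_mult_distrib)
      hence "c m * c m = of_real ((ell_W m)\<^sup>2)"
        by (simp add: c_def power2_eq_square mult_ac)
      moreover have "(w\<^sup>2) ^ m = w ^ m * w ^ m"
        by (simp add: power2_eq_square power_mult_distrib)
      moreover have "c m * w ^ m * (2 * pi * c m * w ^ m) = 2 * pi * ((c m * c m) * (w ^ m * w ^ m))"
        by (simp only: mult_ac)
      ultimately show ?thesis by simp
    qed
    ultimately show "(\<lambda>m. c m * w ^ m * (2 * pi * c m * w ^ m)) sums (2 * pi * ell_A (w\<^sup>2))"
      by (simp only:)
  qed
  from has_integral_mult_right[OF has_integral_fold_symmetric[OF this], of "1/2"]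
  show ?thesis by (simp add: q_def mult_ac)
qed

lemma cnj_powr_minus_half:
  assumes "Re u > 0"
  shows "cnj u powr (-1/2) = cnj (u powr (-1/2))"
proof -
  have "u \<notin> \<real>\<^sub>\<le>\<^sub>0" using assms by (auto simp: complex_nonpos_Reals_iff)
  moreover have "u \<noteq> 0" using assms by auto
  ultimately show ?thesis by (simp add: powr_def cnj_Ln exp_cnj)
qed

text \<open>For real \<open>w\<close> the two factors in \<open>ell_A_parseval\<close> are conjugate, and their product is
\<open>1 / sqrt (1 + 2 w cos t + w\<^sup>2)\<close>. The double-angle formula for \<open>cos t\<close> makes this the integrand of
\<open>ell_A_elliptic_integral\<close> at \<open>t/2\<close>.\<close>
lemma ell_A_landen_real:
  fixes w :: real
  assumes w: "0 \<le> w" "w < 1"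
  shows "ell_A (4 * w / (1 + w)\<^sup>2) = (1 + w) * ell_A (w\<^sup>2)"
proof -
  define z where "z = 4 * w / (1 + w)\<^sup>2"
  have "(1 + w)\<^sup>2 - 4 * w = (1 - w)\<^sup>2" by (simp add: power2_eq_square algebra_simps)
  moreover have "(1 - w)\<^sup>2 > 0" using w by (intro zero_less_power) simp
  ultimately have "4 * w < (1 + w)\<^sup>2" by linarith
  hence z: "0 \<le> z" "z < 1" using w by (auto simp: z_def divide_simps)
  have id: "1 - z * (sin (t/2))\<^sup>2 = (1 + 2 * w * cos t + w\<^sup>2) / (1 + w)\<^sup>2" for t
  proof -
    have "cos t = 1 - 2 * (sin (t/2))\<^sup>2" using cos_double_sin[of "t/2"] by simp
    hence "(1 + w)\<^sup>2 - 4 * w * (sin (t/2))\<^sup>2 = 1 + 2 * w * cos t + w\<^sup>2"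
      by (simp only:) (simp add: power2_eq_square algebra_simps)
    thus ?thesis using w by (simp add: z_def diff_divide_distrib[symmetric] divide_simps)
  qed
  have "((\<lambda>t. 1 / sqrt (1 - z * (sin (1/2 * t))\<^sup>2)) has_integral (1 / \<bar>1/2\<bar>) *\<^sub>R (pi/2 * ell_A z))
          ((\<lambda>x. x / (1/2)) ` {0..pi/2})"
    by (rule has_integral_stretch_real[OF ell_A_elliptic_integral[OF z]]) auto
  moreover have "(\<lambda>x::real. x / (1/2)) ` {0..pi/2} = {0..pi}"
    using image_mult_atLeastAtMost[of 2 0 "pi/2"] by (simp add: mult.commute)
  ultimately have I1: "((\<lambda>t. 1 / sqrt (1 - z * (sin (t/2))\<^sup>2)) has_integral (pi * ell_A z)) {0..pi}"
    by simp
  have "((\<lambda>t. (1 + of_real w * cis t) powr (-1/2) * (1 + of_real w * cis (-t)) powr (-1/2))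
           has_integral (of_real pi * ell_A ((complex_of_real w)\<^sup>2))) {0..pi}"
    by (rule ell_A_parseval) (use w in auto)
  moreover have "(1 + of_real w * cis t) powr (-1/2) * (1 + of_real w * cis (-t)) powr (-1/2)
      = complex_of_real (1 / (1 + w) * (1 / sqrt (1 - z * (sin (t/2))\<^sup>2)))" for t
  proof -
    define u where "u = 1 + of_real w * cis t"
    have "\<bar>w * cos t\<bar> \<le> w * 1" unfolding abs_mult using w by (intro mult_mono) auto
    hence u: "Re u > 0" using w by (simp add: u_def)
    have "1 + of_real w * cis (-t) = cnj u" by (simp add: u_def cis_cnj)
    hence "(1 + of_real w * cis t) powr (-1/2) * (1 + of_real w * cis (-t)) powr (-1/2)
       = of_real ((norm (u powr (-1/2)))\<^sup>2)"
      using u unfolding u_def[symmetric]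
      by (simp only: cnj_powr_minus_half complex_norm_square)
    also have "norm (u powr (-1/2)) = norm u powr (-1/2)"
      by (subst norm_powr_real_powr') auto
    also have "(norm u powr (-1/2))\<^sup>2 = 1 / norm u"
      using u by (auto simp: power2_eq_square powr_minus divide_simps simp flip: powr_add)
    also have "norm u = sqrt (1 + 2 * w * cos t + w\<^sup>2)"
    proof -
      have "(1 + w * cos t)\<^sup>2 + (w * sin t)\<^sup>2 = 1 + 2 * w * cos t + w\<^sup>2 * ((cos t)\<^sup>2 + (sin t)\<^sup>2)"
        by (simp add: power2_eq_square algebra_simps del: sin_cos_squared_add sin_cos_squared_add2 sin_cos_squared_add3)
      thus ?thesis by (simp add: cmod_def u_def)
    qed
    also have "1 / sqrt (1 + 2 * w * cos t + w\<^sup>2) = 1 / (1 + w) * (1 / sqrt (1 - z * (sin (t/2))\<^sup>2))"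
      unfolding id using w by (simp add: real_sqrt_divide)
    finally show ?thesis .
  qed
  moreover have "complex_of_real pi * ell_A ((complex_of_real w)\<^sup>2) = of_real (pi * ell_A (w\<^sup>2))"
  proof -
    have "\<bar>w\<^sup>2\<bar> < 1" using w by (simp add: power_less_one_iff)
    from ell_A_of_real[OF this] show ?thesis by simp
  qed
  ultimately have "((\<lambda>t. complex_of_real (1 / (1 + w) * (1 / sqrt (1 - z * (sin (t/2))\<^sup>2)))) has_integral
      (of_real (pi * ell_A (w\<^sup>2)))) {0..pi}"
    by (simp only:)
  from has_integral_linear[OF this bounded_linear_Re]
  have "((\<lambda>t. Re (complex_of_real (1 / (1 + w) * (1 / sqrt (1 - z * (sin (t/2))\<^sup>2))))) has_integral
      Re (of_real (pi * ell_A (w\<^sup>2)))) {0..pi}"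
    by (simp only: o_def)
  hence "((\<lambda>t. 1 / (1 + w) * (1 / sqrt (1 - z * (sin (t/2))\<^sup>2))) has_integral (pi * ell_A (w\<^sup>2))) {0..pi}"
    by (simp only: Re_complex_of_real)
  moreover have "((\<lambda>t. 1 / (1 + w) * (1 / sqrt (1 - z * (sin (t/2))\<^sup>2))) has_integral
     (1 / (1 + w) * (pi * ell_A z))) {0..pi}"
    by (intro has_integral_mult_right I1)
  ultimately have "1 / (1 + w) * (pi * ell_A z) = pi * ell_A (w\<^sup>2)"
    by (rule has_integral_unique[rotated])
  hence "pi * (ell_A z / (1 + w)) = pi * ell_A (w\<^sup>2)" by simp
  hence "ell_A z / (1 + w) = ell_A (w\<^sup>2)"
    by (rule mult_left_cancel[THEN iffD1, rotated]) simp
  thus ?thesis using w by (simp add: z_def field_simps)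
qed

lemma norm_koebe_lt:
  fixes w :: complex
  assumes "norm w < 1/8"
  shows "norm (4 * w / (1 + w)\<^sup>2) < 1"
proof -
  have "norm (1 + w) \<ge> 7/8" using norm_diff_ineq[of 1 w] assms by simp
  hence "norm (1 + w) ^ 2 \<ge> (7/8)^2" by (intro power_mono) auto
  hence "4 * norm w < norm (1 + w) ^ 2" using assms by (simp add: power2_eq_square)
  moreover have "norm (1 + w) ^ 2 > 0" using \<open>norm (1 + w) \<ge> 7/8\<close> by (intro zero_less_power) linarith
  ultimately show ?thesis by (simp add: norm_divide norm_mult norm_power)
qed

lemma ell_A_landen:
  fixes w :: complex
  assumes w: "norm w < 1/8"
  shows "ell_A (4 * w / (1 + w)\<^sup>2) = (1 + w) * ell_A (w\<^sup>2)"
proof -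
  have nz: "1 + w \<noteq> 0" if "norm w < 1/8" for w :: complex
    using that norm_diff_ineq[of 1 w] by force
  have "ell_A (4 * w / (1 + w)\<^sup>2) - (1 + w) * ell_A (w\<^sup>2) = 0"
  proof (rule analytic_continuation[where S = "ball 0 (1/8)" and U = "of_real ` {0<..<1/8}" and \<xi> = 0
        and f = "\<lambda>w. ell_A (4 * w / (1 + w)\<^sup>2) - (1 + w) * ell_A (w\<^sup>2)"])
    have 1: "(ell_A \<circ> (\<lambda>w. 4 * w / (1 + w)\<^sup>2)) holomorphic_on ball (0::complex) (1/8)"
      by (rule holomorphic_on_compose_gen[OF _ ell_A_holomorphic])
         (use nz norm_koebe_lt in \<open>auto intro!: holomorphic_intros\<close>)
    have 2: "(ell_A \<circ> (\<lambda>w. w\<^sup>2)) holomorphic_on ball (0::complex) (1/8)"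
      by (rule holomorphic_on_compose_gen[OF _ ell_A_holomorphic])
         (auto intro!: holomorphic_intros simp: norm_power power_less_one_iff)
    show "(\<lambda>w. ell_A (4 * w / (1 + w)\<^sup>2) - (1 + w) * ell_A (w\<^sup>2)) holomorphic_on ball (0::complex) (1/8)"
      using 1 2 by (intro holomorphic_intros) (auto simp: o_def)
    show "(0::complex) islimpt of_real ` {0<..<1/8::real}"
      unfolding islimpt_approachable
    proof safe
      fix e :: real assume "e > 0"
      define d where "d = min e (1/8) / 2"
      have "d > 0" "d < e" "d < 1/8" using \<open>e > 0\<close> by (auto simp: d_def)
      thus "\<exists>x'\<in>complex_of_real ` {0<..<1/8}. x' \<noteq> 0 \<and> dist x' 0 < e"
        by (intro bexI[of _ "of_real d"]) auto
    qed
    fix z assume "z \<in> complex_of_real ` {0<..<1/8::real}"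
    then obtain x where x: "z = of_real x" "x > 0" "x < 1/8" by auto
    have "4 * z / (1 + z)\<^sup>2 = of_real (4 * x / (1 + x)\<^sup>2)" using x by simp
    moreover have "\<bar>4 * x / (1 + x)\<^sup>2\<bar> < 1"
      using norm_koebe_lt[of "of_real x"] x calculation by (simp only: norm_of_real)
    moreover have "z\<^sup>2 = of_real (x\<^sup>2)" "\<bar>x\<^sup>2\<bar> < 1" using x by (auto simp: power_less_one_iff)
    ultimately show "ell_A (4 * z / (1 + z)\<^sup>2) - (1 + z) * ell_A (z\<^sup>2) = 0"
      using ell_A_landen_real[of x] x by (simp only: ell_A_of_real) simp
  qed (use w in \<open>auto simp: image_subset_iff\<close>)
  thus ?thesis by simp
qed

section \<open>The inequality between \<open>A (1 - y) / A y\<close> and the logarithm\<close>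

lemma ell_A_ge_1:
  fixes y :: real
  assumes "0 \<le> y" "y < 1"
  shows "ell_A y \<ge> 1"
proof -
  have "(\<lambda>n. (ell_W n)\<^sup>2 * y ^ n) sums ell_A y" using ell_A_sums[of y] assms by simp
  moreover have "(\<lambda>n. if n = 0 then (1::real) else 0) sums 1" using sums_single[of 0 "\<lambda>_. 1::real"] by simp
  ultimately show ?thesis by (elim sums_le[rotated]) (use assms in auto)
qed

lemma ell_A_le:
  fixes y :: real
  assumes "0 \<le> y" "y < 1"
  shows "ell_A y - 1 \<le> y / (4 * (1 - y))"
proof -
  have "(\<lambda>n. (ell_W n)\<^sup>2 * y ^ n) sums ell_A y" using ell_A_sums[of y] assms by simp
  hence 1: "(\<lambda>n. (ell_W (Suc n))\<^sup>2 * y ^ Suc n) sums (ell_A y - 1)"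
    by (subst sums_Suc_iff) simp
  have "(\<lambda>n. (y / 4) * y ^ n) sums ((y / 4) * (1 / (1 - y)))"
    by (intro sums_mult geometric_sums) (use assms in auto)
  hence 2: "(\<lambda>n. 1/4 * y ^ Suc n) sums (y / (4 * (1 - y)))" by (simp add: mult_ac)
  show ?thesis
    by (rule sums_le[OF _ 1 2]) (intro mult_right_mono ell_W_sq_le_quarter, use assms in auto)
qed

text \<open>Termwise comparison with \<open>- ln (1 - x) = \<Sum>n. x\<^sup>n\<^sup>+\<^sup>1 / (n + 1)\<close> at \<open>x = 1 - y\<close>.\<close>
lemma ell_A_complementary_ge_ln:
  assumes y: "0 < y" "y < 1"
  shows "1/2 * ln (1 / y) \<le> pi / 2 * ell_A (1 - y)"
proof -
  define x where "x = 1 - y"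
  have x: "0 < x" "x < 1" using y by (auto simp: x_def)
  have "(\<lambda>n. - ((- (- x)) ^ n) / of_nat n) sums ln (1 + (-x))"
    by (rule ln_series') (use x in auto)
  hence "(\<lambda>n. - (x ^ Suc n) / of_nat (Suc n)) sums ln y"
    using sums_Suc_iff[of "\<lambda>n. - (x ^ n) / of_nat n" "ln y"] by (simp add: x_def)
  from sums_mult[OF this, of "-1/2"]
  have 1: "(\<lambda>n. 1/2 * (x ^ Suc n / of_nat (Suc n))) sums (1/2 * ln (1 / y))"
    using y by (simp add: ln_div)
  have 2: "(\<lambda>n. pi / 2 * ((ell_W n)\<^sup>2 * x ^ n)) sums (pi / 2 * ell_A (1 - y))"
    using ell_A_sums[of x] x by (intro sums_mult) (simp add: x_def)
  show ?thesis
  proof (rule sums_le[OF _ 1 2])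
    fix n
    have "1/2 * (x ^ Suc n / of_nat (Suc n)) \<le> 1/2 * (x ^ n / (real n + 1/2))"
      using x by (intro mult_left_mono frac_le) (auto simp: mult_left_le_one_le)
    also have "\<dots> = pi / 2 * (1 / (pi * (real n + 1/2)) * x ^ n)"
      unfolding divide_divide_eq_left[symmetric] by (simp del: divide_divide_eq_left)
    also have "\<dots> \<le> pi / 2 * ((ell_W n)\<^sup>2 * x ^ n)"
      using x ell_W_sq_ge[of n] by (intro mult_left_mono mult_right_mono) auto
    finally show "1/2 * (x ^ Suc n / of_nat (Suc n)) \<le> pi / 2 * ((ell_W n)\<^sup>2 * x ^ n)" .
  qed
qed

text \<open>Let \<open>E y\<close> be the difference of both sides divided by \<open>A y\<close>. Landen's transformation, applied once to
\<open>y = 4 v / (1 + v)\<^sup>2\<close> and once to the complementary argument, halves the quotient \<open>A (1 - y) / A y\<close>, whence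
\<open>E y > 1/2 E (v\<^sup>2)\<close>. As \<open>E\<close> is bounded below, its infimum \<open>m\<close> satisfies \<open>m \<ge> m/2\<close>; so \<open>m \<ge> 0\<close>, and
the strict inequality gives \<open>E y > 0\<close>.\<close>
lemma ell_A_ratio_gt_ln:
  assumes y: "0 < y" "y < 1"
  shows "1/2 * ln (16 * (1 - y) / y) * ell_A y < pi / 2 * ell_A (1 - y)"
proof -
  define E where "E = (\<lambda>y. pi / 2 * ell_A (1 - y) / ell_A y - 1/2 * ln (16 * (1 - y) / y))"
  have E_ge: "E y \<ge> - (1/8) - 1/2 * ln 16" if y: "0 < y" "y < 1" for y
  proof -
    have A1: "ell_A y \<ge> 1" and A2: "ell_A y - 1 \<le> y / (4 * (1 - y))"
      using ell_A_ge_1[of y] ell_A_le[of y] y by auto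
    have l0: "ln (1 / y) \<ge> 0" using y by simp
    have "ln (1 / y) \<le> 1 / y - 1" using y by (intro ln_le_minus_one) auto
    hence l: "ln (1 / y) \<le> (1 - y) / y" using y by (simp add: field_simps)
    have "ln (1 / y) * (1 - 1 / ell_A y) \<le> ln (1 / y) * (ell_A y - 1)"
    proof (intro mult_left_mono l0)
      have "1 - 1 / ell_A y = (ell_A y - 1) * (1 / ell_A y)" using A1 by (simp add: field_simps)
      also have "\<dots> \<le> (ell_A y - 1) * 1" using A1 by (intro mult_left_mono) auto
      finally show "1 - 1 / ell_A y \<le> ell_A y - 1" by simp
    qed
    also have "\<dots> \<le> (1 - y) / y * (y / (4 * (1 - y)))"
      using l0 l A1 A2 y by (intro mult_mono) auto
    also have "\<dots> = 1/4" using y by (simp add: field_simps)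
    finally have 1: "ln (1 / y) - ln (1 / y) / ell_A y \<le> 1/4" by (simp add: algebra_simps)
    have "1/2 * ln (1 / y) / ell_A y \<le> pi / 2 * ell_A (1 - y) / ell_A y"
      using A1 ell_A_complementary_ge_ln[OF y] by (intro divide_right_mono) auto
    moreover have "ln (16 * (1 - y) / y) \<le> ln 16 + ln (1 / y)"
    proof -
      have "ln (16 * (1 - y) / y) \<le> ln (16 * (1 / y))" using y by (subst ln_le_cancel_iff) (auto simp: field_simps)
      also have "\<dots> = ln 16 + ln (1 / y)" using y by (subst ln_mult) auto
      finally show ?thesis .
    qed
    ultimately show ?thesis using 1 unfolding E_def by simp
  qed
  \<comment> \<open>The witness \<open>v\<^sup>2\<close> is the parameter one Landen step down; \<open>s\<close> is the complementary modulus of \<open>y\<close>.\<close>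
  have step: "\<exists>y'. 0 < y' \<and> y' < 1 \<and> E y > 1/2 * E y'" if y: "0 < y" "y < 1" for y
  proof -
    define s where "s = sqrt (1 - y)"
    have s: "0 < s" "s < 1" "s\<^sup>2 = 1 - y" using y by (auto simp: s_def)
    define v where "v = (1 - s) / (1 + s)"
    have v: "0 < v" "v < 1" using s by (auto simp: v_def field_simps)
    have sv: "(1 + s) * (1 + v) = 2" using s by (simp add: v_def field_simps)
    have v1: "1 + v = 2 / (1 + s)" using s by (simp add: v_def field_simps)
    have yv: "4 * v / (1 + v)\<^sup>2 = y"
    proof -
      have "4 * v / (1 + v)\<^sup>2 = (1 - s) * (1 + s)"
        unfolding v1 using s by (simp add: v_def power2_eq_square)
      also have "\<dots> = y" using s(3) by (simp add: power2_eq_square algebra_simps)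
      finally show ?thesis .
    qed
    have vs: "4 * s / (1 + s)\<^sup>2 = 1 - v\<^sup>2"
    proof -
      have "1 - v\<^sup>2 = ((1 + s)\<^sup>2 - (1 - s)\<^sup>2) / (1 + s)\<^sup>2"
        unfolding v_def power_divide using s by (simp add: diff_divide_distrib)
      also have "(1 + s)\<^sup>2 - (1 - s)\<^sup>2 = 4 * s" by (simp add: power2_eq_square algebra_simps)
      finally show ?thesis ..
    qed
    have v2: "0 < v\<^sup>2" "v\<^sup>2 < 1" using v by (auto simp: power_less_one_iff)
    have L1: "ell_A y = (1 + v) * ell_A (v\<^sup>2)" using ell_A_landen_real[of v] v yv by simp
    have L2: "ell_A (1 - v\<^sup>2) = (1 + s) * ell_A (1 - y)" using ell_A_landen_real[of s] s vs by simp
    have ratio: "ell_A (1 - y) / ell_A y = 1/2 * (ell_A (1 - v\<^sup>2) / ell_A (v\<^sup>2))"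
    proof -
      have "ell_A (v\<^sup>2) > 0" using ell_A_ge_1[of "v\<^sup>2"] v2 by linarith
      have "1/2 * (ell_A (1 - v\<^sup>2) / ell_A (v\<^sup>2)) =
         1/2 * ((1 + s) * (1 + v)) * (ell_A (1 - y) / ell_A y)"
      proof -
        have "1/2 * (p * A / a) = 1/2 * (p * d) * (A / (d * a))" if "d \<noteq> 0" "a \<noteq> 0" for p A a d :: real
          using that by (simp add: field_simps)
        thus ?thesis unfolding L1 L2 using v \<open>ell_A (v\<^sup>2) > 0\<close> by simp
      qed
      thus ?thesis unfolding sv by simp
    qed
    have "pi / 2 * ell_A (1 - y) / ell_A y = pi / 2 * (ell_A (1 - y) / ell_A y)" by simp
    also have "\<dots> = 1/2 * (pi / 2 * ell_A (1 - v\<^sup>2) / ell_A (v\<^sup>2))"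
      by (subst ratio) simp
    finally have EE: "E y - 1/2 * E (v\<^sup>2) = 1/4 * (ln (16 * (1 - v\<^sup>2) / v\<^sup>2) - 2 * ln (16 * (1 - y) / y))"
    proof -
      have "a - 1/2 * l1 - 1/2 * (b - 1/2 * l2) = 1/4 * (l2 - 2 * l1)"
        if "a = 1/2 * b" for a b l1 l2 :: real using that by (simp add: field_simps)
      thus "pi / 2 * ell_A (1 - y) / ell_A y = 1/2 * (pi / 2 * ell_A (1 - v\<^sup>2) / ell_A (v\<^sup>2)) \<Longrightarrow> ?thesis"
        unfolding E_def .
    qed
    have "2 * ln (16 * (1 - y) / y) = ln ((16 * (1 - y) / y)\<^sup>2)"
      using y by (subst ln_realpow) auto
    also have "(1 - y) / y = (1 - v)\<^sup>2 / (4 * v)"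
    proof -
      have "(1 - p / q) / (p / q) = (q - p) / p" if "p \<noteq> 0" "q \<noteq> 0" for p q :: real
        using that by (simp add: field_simps)
      from this[of "4 * v" "(1 + v)\<^sup>2"] v
      have "(1 - y) / y = ((1 + v)\<^sup>2 - 4 * v) / (4 * v)" unfolding yv by simp
      also have "(1 + v)\<^sup>2 - 4 * v = (1 - v)\<^sup>2" by (simp add: power2_eq_square algebra_simps)
      finally show ?thesis .
    qed
    hence "(16 * (1 - y) / y)\<^sup>2 = (16 * ((1 - v)\<^sup>2 / (4 * v)))\<^sup>2" by (metis times_divide_eq_right)
    also have "\<dots> = 16 * (1 - v) ^ 4 / v\<^sup>2"
      using v by (simp add: power_divide power_mult_distrib)
    also have "ln \<dots> < ln (16 * (1 - v\<^sup>2) / v\<^sup>2)"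
    proof (subst ln_less_cancel_iff)
      have "(1 - v) ^ 4 = (1 - v) * (1 - v) ^ 3" by (simp add: numeral_eq_Suc)
      also have "(1 - v) ^ 3 < 1" using v by (subst power_less_one_iff) auto
      hence "(1 - v) * (1 - v) ^ 3 < (1 - v) * 1" using v by (intro mult_strict_left_mono) auto
      also have "\<dots> < (1 - v) * (1 + v)" using v by (intro mult_strict_left_mono) auto
      also have "\<dots> = 1 - v\<^sup>2" by (simp add: power2_eq_square algebra_simps)
      finally show "16 * (1 - v) ^ 4 / v\<^sup>2 < 16 * (1 - v\<^sup>2) / v\<^sup>2"
        using v by (intro divide_strict_right_mono) auto
    qed (use v v2 in auto)
    finally show ?thesis using EE v2 by (intro exI[of _ "v\<^sup>2"]) auto
  qed
  define m where "m = Inf (E ` {0<..<1})"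
  have bdd: "bdd_below (E ` {0<..<1})" using E_ge by (intro bdd_belowI2) auto
  have m_le: "m \<le> E y" if "0 < y" "y < 1" for y
    unfolding m_def by (intro cInf_lower bdd imageI) (use that in auto)
  have "m \<ge> 1/2 * m" unfolding m_def
  proof (rule cInf_greatest)
    fix e assume "e \<in> E ` {0<..<1}"
    then obtain y where y: "0 < y" "y < 1" "e = E y" by auto
    then obtain y' where "0 < y'" "y' < 1" "E y > 1/2 * E y'" using step by blast
    thus "1/2 * Inf (E ` {0<..<1}) \<le> e" using m_le[of y'] y by (simp add: m_def)
  qed auto
  hence "m \<ge> 0" by simp
  moreover obtain y' where "0 < y'" "y' < 1" "E y > 1/2 * E y'" using step[OF y] by blast
  ultimately have "E y > 0" using m_le[of y'] by linarith
  moreover have "ell_A y > 0" using ell_A_ge_1[of y] y by linarith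
  ultimately show ?thesis by (simp add: E_def field_simps)
qed

section \<open>Boundary values of \<open>A\<close> on the unit circle\<close>

lemma two_cos_plus: "2 * cos a + 2 * cos b = 4 * ((cos (a/2))\<^sup>2 - (sin (b/2))\<^sup>2)" for a b :: real
  using cos_double_cos[of "a/2"] cos_double_sin[of "b/2"] by simp

text \<open>The classical substitution \<open>sin (\<psi>/2) = cos (\<theta>/2) sin \<phi>\<close> turns this improper integral into a
complete elliptic integral.\<close>
lemma has_integral_mehler:
  assumes \<theta>: "0 < \<theta>" "\<theta> < pi"
  shows "((\<lambda>\<psi>. 1 / sqrt (2 * cos \<theta> + 2 * cos \<psi>)) has_integral (pi/2 * ell_A ((cos (\<theta>/2))\<^sup>2))) {0..pi-\<theta>}"
proof -
  define c where "c = cos (\<theta>/2)"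
  have c: "0 < c" "c < 1"
    using \<theta> cos_monotone_0_pi[of 0 "\<theta>/2"] by (auto simp: c_def intro!: cos_gt_zero)
  have c2: "c\<^sup>2 < 1" using c by (simp add: power_less_one_iff)
  define g where "g = (\<lambda>\<phi>. 2 * arcsin (c * sin \<phi>))"
  define h where "h = (\<lambda>\<psi>. 1 / sqrt (2 * cos \<theta> + 2 * cos \<psi>))"
  define S where "S = {0<..<pi/2}"
  have sin_S: "0 < sin \<phi>" "sin \<phi> < 1" "0 < cos \<phi>" if "\<phi> \<in> S" for \<phi>
  proof -
    show "0 < sin \<phi>" "0 < cos \<phi>" using that by (auto simp: S_def intro!: sin_gt_zero cos_gt_zero)
    have "sin \<phi> \<noteq> 1" using cos_squared_eq[of \<phi>] \<open>0 < cos \<phi>\<close> by auto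
    thus "sin \<phi> < 1" using sin_le_one[of \<phi>] by linarith
  qed
  have cs: "0 < c * sin \<phi>" "c * sin \<phi> < c" "c * sin \<phi> < 1" if "\<phi> \<in> S" for \<phi>
    using sin_S[OF that] c by (auto intro: mult_strict_mono[of c 1 "sin \<phi>" 1, simplified])
  have half: "sin (g \<phi> / 2) = c * sin \<phi>" if "\<phi> \<in> S" for \<phi>
    using cs[OF that] by (simp add: g_def)
  have arcc: "arcsin c = (pi - \<theta>) / 2"
  proof -
    have "c = sin ((pi - \<theta>) / 2)" unfolding c_def by (simp add: cos_sin_eq diff_divide_distrib)
    thus ?thesis using \<theta> by (simp add: arcsin_sin)
  qed
  have img: "g ` S = {0<..<pi-\<theta>}"
  proof (intro equalityI subsetI)
    fix \<psi> assume "\<psi> \<in> g ` S"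
    then obtain \<phi> where \<phi>: "\<phi> \<in> S" "\<psi> = g \<phi>" by blast
    have "arcsin 0 < arcsin (c * sin \<phi>)" using cs[OF \<phi>(1)] by (intro arcsin_less_arcsin) auto
    moreover have "arcsin (c * sin \<phi>) < arcsin c" using cs[OF \<phi>(1)] c by (intro arcsin_less_arcsin) auto
    ultimately show "\<psi> \<in> {0<..<pi-\<theta>}" using \<phi> by (simp add: g_def arcc)
  next
    fix \<psi> assume \<psi>: "\<psi> \<in> {0<..<pi-\<theta>}"
    have s: "0 < sin (\<psi>/2)" using \<psi> \<theta> by (intro sin_gt_zero) auto
    have "sin (\<psi>/2) < sin ((pi-\<theta>)/2)" using \<psi> \<theta> by (intro sin_monotone_2pi) auto
    also have "\<dots> = c" unfolding c_def by (simp add: cos_sin_eq diff_divide_distrib)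
    finally have s2: "sin (\<psi>/2) < c" .
    define \<phi> where "\<phi> = arcsin (sin (\<psi>/2) / c)"
    have "0 < sin (\<psi>/2) / c" "sin (\<psi>/2) / c < 1" using s s2 c by auto
    hence "arcsin 0 < \<phi>" "\<phi> < arcsin 1" unfolding \<phi>_def by (intro arcsin_less_arcsin; simp)+
    hence "\<phi> \<in> S" by (simp add: S_def)
    moreover have "g \<phi> = \<psi>"
      using \<open>0 < sin (\<psi>/2) / c\<close> \<open>sin (\<psi>/2) / c < 1\<close> c \<psi> \<theta> by (simp add: g_def \<phi>_def arcsin_sin)
    ultimately show "\<psi> \<in> g ` S" by blast
  qed
  have deriv: "(g has_field_derivative (2 * (c * cos \<phi> / sqrt (1 - (c * sin \<phi>)\<^sup>2)))) (at \<phi> within S)"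
    if "\<phi> \<in> S" for \<phi>
    unfolding g_def using cs[OF that]
    by (auto intro!: derivative_eq_intros simp: divide_inverse)
  have inj: "inj_on g S"
  proof (rule inj_onI)
    fix x y assume xy: "x \<in> S" "y \<in> S" "g x = g y"
    hence "sin x = sin y" using half[of x] half[of y] c by simp
    thus "x = y" using xy by (intro sin_inj_pi[of x y]) (auto simp: S_def)
  qed
  have prod: "\<bar>2 * (c * cos \<phi> / sqrt (1 - (c * sin \<phi>)\<^sup>2))\<bar> * h (g \<phi>) = 1 / sqrt (1 - c\<^sup>2 * (sin \<phi>)\<^sup>2)"
    if "\<phi> \<in> S" for \<phi>
  proof -
    have "2 * cos \<theta> + 2 * cos (g \<phi>) = 4 * (c\<^sup>2 - (c * sin \<phi>)\<^sup>2)"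
      unfolding two_cos_plus half[OF that] c_def ..
    also have "\<dots> = 4 * c\<^sup>2 * (1 - (sin \<phi>)\<^sup>2)" by (simp add: power_mult_distrib algebra_simps)
    also have "\<dots> = (2 * c * cos \<phi>)\<^sup>2" by (simp add: power_mult_distrib flip: cos_squared_eq)
    finally have "h (g \<phi>) = 1 / (2 * c * cos \<phi>)" using c sin_S[OF that] by (simp add: h_def)
    moreover have "(c * sin \<phi>)\<^sup>2 < 1" using cs[OF that] by (simp add: power_less_one_iff)
    ultimately show ?thesis using c sin_S[OF that]
      by (simp add: abs_mult power_mult_distrib)
  qed
  have I: "((\<lambda>\<phi>. 1 / sqrt (1 - c\<^sup>2 * (sin \<phi>)\<^sup>2)) has_integral (pi/2 * ell_A (c\<^sup>2))) S"
    using ell_A_elliptic_integral[of "c\<^sup>2"] c2 by (simp add: S_def has_integral_Icc_iff_Ioo)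
  have I': "((\<lambda>\<phi>. \<bar>2 * (c * cos \<phi> / sqrt (1 - (c * sin \<phi>)\<^sup>2))\<bar> * h (g \<phi>)) has_integral (pi/2 * ell_A (c\<^sup>2))) S"
    using I prod by (subst has_integral_cong[OF prod])
  have nonneg: "0 \<le> \<bar>2 * (c * cos \<phi> / sqrt (1 - (c * sin \<phi>)\<^sup>2))\<bar> * h (g \<phi>)" if "\<phi> \<in> S" for \<phi>
  proof -
    have "c\<^sup>2 * (sin \<phi>)\<^sup>2 \<le> 1" using cs[OF that] by (simp add: power_le_one_iff flip: power_mult_distrib)
    thus ?thesis unfolding prod[OF that] by simp
  qed
  have "(\<lambda>\<phi>. \<bar>2 * (c * cos \<phi> / sqrt (1 - (c * sin \<phi>)\<^sup>2))\<bar> * h (g \<phi>)) absolutely_integrable_on S"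
    using I' nonneg by (intro nonnegative_absolutely_integrable_1) auto
  hence "h absolutely_integrable_on (g ` S) \<and> integral (g ` S) h = pi/2 * ell_A (c\<^sup>2)"
    using has_absolute_integral_change_of_variables_1'[OF _ deriv inj, of h "pi/2 * ell_A (c\<^sup>2)"] I'
    by (simp add: S_def integral_unique)
  hence "(h has_integral (pi/2 * ell_A (c\<^sup>2))) {0<..<pi-\<theta>}"
    unfolding img using absolutely_integrable_on_def has_integral_iff by blast
  thus ?thesis unfolding h_def c_def by (simp add: has_integral_Icc_iff_Ioo)
qed

text \<open>The reflection \<open>\<psi> \<mapsto> \<pi> - \<psi>\<close> exchanges the roles of \<open>\<theta>\<close> and \<open>\<pi> - \<theta>\<close> in the previous lemma.\<close>
lemma has_integral_mehler':
  assumes \<theta>: "0 < \<theta>" "\<theta> < pi"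
  shows "((\<lambda>\<psi>. 1 / sqrt (- 2 * cos \<theta> - 2 * cos \<psi>)) has_integral (pi/2 * ell_A ((sin (\<theta>/2))\<^sup>2))) {pi-\<theta>..pi}"
proof -
  have "((\<lambda>\<psi>. 1 / sqrt (2 * cos (pi-\<theta>) + 2 * cos \<psi>)) has_integral
     (pi/2 * ell_A ((cos ((pi-\<theta>)/2))\<^sup>2))) (cbox 0 (pi-(pi-\<theta>)))"
    using has_integral_mehler[of "pi-\<theta>"] \<theta> by simp
  from has_integral_affinity[OF this, of "-1" pi]
  have "((\<lambda>\<psi>. 1 / sqrt (2 * cos (pi-\<theta>) + 2 * cos (-1 * \<psi> + pi))) has_integral
     (pi/2 * ell_A ((cos ((pi-\<theta>)/2))\<^sup>2))) ((\<lambda>x. (1/(-1)) * x + -((1/(-1)) * pi)) ` cbox 0 (pi-(pi-\<theta>)))"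
    by simp
  moreover have "(\<lambda>x. (1/(-1)) * x + -((1/(-1)) * pi)) ` cbox 0 (pi-(pi-\<theta>)) = {pi-\<theta>..pi}"
    by (auto intro!: image_eqI[of _ _ "pi - x" for x])
  moreover have "cos ((pi-\<theta>)/2) = sin (\<theta>/2)" by (simp add: cos_sin_eq diff_divide_distrib)
  ultimately show ?thesis by simp
qed

lemma one_plus_cis_eq: "1 + cis \<phi> = of_real (2 * cos (\<phi>/2)) * cis (\<phi>/2)"
proof -
  have "1 + cos \<phi> = 2 * (cos (\<phi>/2) * cos (\<phi>/2))"
    using cos_double_cos[of "\<phi>/2"] by (simp add: power2_eq_square)
  moreover have "sin \<phi> = 2 * sin (\<phi>/2) * cos (\<phi>/2)" using sin_double[of "\<phi>/2"] by simp
  ultimately show ?thesis by (simp add: complex_eq_iff)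
qed

lemma one_plus_cis_powr:
  assumes "-pi < \<phi>" "\<phi> < pi"
  shows "(1 + cis \<phi>) powr (-1/2) = of_real (1 / sqrt (2 * cos (\<phi>/2))) * cis (-\<phi>/4)"
proof -
  define \<rho> where "\<rho> = 2 * cos (\<phi>/2)"
  have \<rho>: "\<rho> > 0" using assms by (auto simp: \<rho>_def intro!: cos_gt_zero_pi)
  define L where "L = of_real (ln \<rho>) + \<i> * of_real (\<phi>/2)"
  have "exp L = of_real \<rho> * cis (\<phi>/2)"
    using \<rho> by (simp add: L_def exp_add cis_conv_exp exp_of_real)
  hence e: "1 + cis \<phi> = exp L" by (simp add: one_plus_cis_eq \<rho>_def)
  have "Ln (exp L) = L" using assms by (intro Ln_exp) (auto simp: L_def)
  hence "(1 + cis \<phi>) powr (-1/2) = exp (-1/2 * L)" unfolding e by (simp add: powr_def)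
  also have "-1/2 * L = of_real (- (ln \<rho> / 2)) + \<i> * of_real (-\<phi>/4)"
    by (simp add: L_def algebra_simps)
  also have "exp \<dots> = of_real (exp (- (ln \<rho> / 2))) * cis (-\<phi>/4)"
    by (simp only: exp_add exp_of_real cis_conv_exp)
  also have "ln \<rho> / 2 = ln (sqrt \<rho>)" using \<rho> by (simp add: ln_sqrt)
  also have "exp (- ln (sqrt \<rho>)) = 1 / sqrt \<rho>" using \<rho> by (simp add: exp_minus field_simps)
  finally show ?thesis by (simp add: \<rho>_def)
qed

text \<open>Moving the point radially to the circle changes the norm by at most \<open>1 - r\<close>, which is itself a lower bound
for \<open>norm (1 + of_real r * cis \<phi>)\<close>. The lemma dominates the integrands of \<open>ell_A_parseval\<close> by their boundary
values, uniformly in \<open>r\<close>.\<close>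
lemma norm_one_plus_ge_half:
  assumes "0 \<le> r" "r \<le> 1"
  shows "norm (1 + of_real r * cis \<phi>) \<ge> 1/2 * norm (1 + cis \<phi>)"
proof -
  have "1 - r \<le> norm (1 + of_real r * cis \<phi>)"
    using norm_diff_ineq[of 1 "of_real r * cis \<phi>"] assms by (simp add: norm_mult)
  moreover have "norm (1 + cis \<phi>) \<le> norm (1 + of_real r * cis \<phi>) + norm (of_real (1 - r) * cis \<phi>)"
    using norm_triangle_ineq[of "1 + of_real r * cis \<phi>" "of_real (1 - r) * cis \<phi>"]
    by (simp add: algebra_simps)
  moreover have "norm (of_real (1 - r) * cis \<phi>) = 1 - r"
    using assms by (simp add: norm_mult del: of_real_diff)
  ultimately show ?thesis by linarith
qed

text \<open>Radial boundary values of \<open>A\<close>, by dominated convergence in \<open>ell_A_parseval\<close>. On the circle the product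
of the two factors has absolute value \<open>1 / sqrt \<bar>2 cos \<theta> + 2 cos \<psi>\<bar>\<close>; its phase is \<open>cis (-\<theta>/2)\<close> before
the singularity \<open>\<psi> = \<pi> - \<theta>\<close> and is multiplied by \<open>\<i>\<close> beyond it. The two pieces are the integrals of
\<open>has_integral_mehler\<close>.\<close>
lemma ell_A_boundary:
  assumes \<theta>: "0 < \<theta>" "\<theta> < pi"
    and r: "\<And>k. 0 < r k" "\<And>k. r k < 1" "r \<longlonglongrightarrow> 1"
  shows "(\<lambda>k. ell_A ((of_real (r k) * cis \<theta>)\<^sup>2)) \<longlonglongrightarrow>
     cis (-\<theta>/2) * (of_real (ell_A ((cos (\<theta>/2))\<^sup>2)) + \<i> * of_real (ell_A ((sin (\<theta>/2))\<^sup>2))) / 2"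
proof -
  define w where "w = (\<lambda>k. of_real (r k) * cis \<theta>)"
  have w: "norm (w k) < 1" for k using r(1)[of k] r(2)[of k] by (simp add: w_def norm_mult)
  \<comment> \<open>The singular angle \<open>\<pi> - \<theta>\<close>, where there is no limit, is removed by the value \<open>0\<close>.\<close>
  define f where "f = (\<lambda>k \<psi>. if \<psi> = pi-\<theta> then 0 else
     (1 + w k * cis \<psi>) powr (-1/2) * (1 + w k * cis (-\<psi>)) powr (-1/2))"
  have If: "(f k has_integral (pi * ell_A ((w k)\<^sup>2))) {0..pi}" for k
    by (rule has_integral_spike_finite[OF _ _ ell_A_parseval[OF w[of k]], of "{pi-\<theta>}"]) (auto simp: f_def)
  define B where "B = (\<lambda>\<psi>. 1 / sqrt \<bar>2 * cos \<theta> + 2 * cos \<psi>\<bar>)"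
  have pos: "2 * cos \<theta> + 2 * cos \<psi> \<ge> 0" if "\<psi> \<in> {0..pi-\<theta>}" for \<psi>
    using cos_monotone_0_pi_le[of \<psi> "pi-\<theta>"] that \<theta> by simp
  have neg: "2 * cos \<theta> + 2 * cos \<psi> \<le> 0" if "\<psi> \<in> {pi-\<theta>..pi}" for \<psi>
    using cos_monotone_0_pi_le[of "pi-\<theta>" \<psi>] that \<theta> by simp
  have B1: "(B has_integral (pi/2 * ell_A ((cos (\<theta>/2))\<^sup>2))) {0..pi-\<theta>}"
    by (rule has_integral_eq[OF _ has_integral_mehler[OF \<theta>]]) (use pos in \<open>simp add: B_def\<close>)
  have B2: "(B has_integral (pi/2 * ell_A ((sin (\<theta>/2))\<^sup>2))) {pi-\<theta>..pi}"
    by (rule has_integral_eq[OF _ has_integral_mehler'[OF \<theta>]])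
       (use neg in \<open>simp add: B_def abs_of_nonpos\<close>)
  define g where "g = (\<lambda>\<psi>. if \<psi> = pi-\<theta> then 0 else
     cis (-\<theta>/2) * ((if \<psi> < pi-\<theta> then 1 else \<i>) * of_real (B \<psi>)))"
  have g1: "(g has_integral (cis (-\<theta>/2) * (1 * of_real (pi/2 * ell_A ((cos (\<theta>/2))\<^sup>2))))) {0..pi-\<theta>}"
  proof (rule has_integral_spike_finite[of "{pi-\<theta>}"])
    show "((\<lambda>\<psi>. cis (-\<theta>/2) * (1 * of_real (B \<psi>))) has_integral (cis (-\<theta>/2) * (1 * of_real (pi/2 * ell_A ((cos (\<theta>/2))\<^sup>2))))) {0..pi-\<theta>}"
      by (intro has_integral_mult_right has_integral_of_real B1)
  qed (auto simp: g_def)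
  have g2: "(g has_integral (cis (-\<theta>/2) * (\<i> * of_real (pi/2 * ell_A ((sin (\<theta>/2))\<^sup>2))))) {pi-\<theta>..pi}"
  proof (rule has_integral_spike_finite[of "{pi-\<theta>}"])
    show "((\<lambda>\<psi>. cis (-\<theta>/2) * (\<i> * of_real (B \<psi>))) has_integral (cis (-\<theta>/2) * (\<i> * of_real (pi/2 * ell_A ((sin (\<theta>/2))\<^sup>2))))) {pi-\<theta>..pi}"
      by (intro has_integral_mult_right has_integral_of_real B2)
  qed (auto simp: g_def)
  have Ig: "(g has_integral (cis (-\<theta>/2) * (1 * of_real (pi/2 * ell_A ((cos (\<theta>/2))\<^sup>2))) +
     cis (-\<theta>/2) * (\<i> * of_real (pi/2 * ell_A ((sin (\<theta>/2))\<^sup>2))))) {0..pi}"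
    by (rule has_integral_combine[of 0 "pi-\<theta>" pi]) (use \<theta> g1 g2 in auto)
  have norm_prod: "norm (1 + cis (\<theta>+\<psi>)) * norm (1 + cis (\<theta>-\<psi>)) = \<bar>2 * cos \<theta> + 2 * cos \<psi>\<bar>" for \<psi>
  proof -
    have "2 * cos \<theta> + 2 * cos \<psi> = 4 * (cos ((\<theta>+\<psi>)/2) * cos ((\<theta>-\<psi>)/2))"
      using cos_plus_cos[of \<theta> \<psi>] by simp
    thus ?thesis unfolding one_plus_cis_eq norm_mult by (simp add: abs_mult)
  qed
  have wcis: "w k * cis \<psi> = of_real (r k) * cis (\<theta>+\<psi>)" for k \<psi>
    by (simp add: w_def cis_mult mult.assoc)
  have nz: "1 + cis \<phi> \<notin> \<real>\<^sub>\<le>\<^sub>0" if "cos \<phi> \<noteq> -1" for \<phi>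
  proof -
    have "cos \<phi> > -1" using that cos_ge_minus_one[of \<phi>] by linarith
    thus ?thesis by (auto simp: complex_nonpos_Reals_iff)
  qed
  have cosne: "cos (\<theta>+\<psi>) \<noteq> -1" "cos (\<theta>-\<psi>) \<noteq> -1" if "\<psi> \<in> {0..pi}" "\<psi> \<noteq> pi-\<theta>" for \<psi>
  proof -
    have "2 * cos \<theta> + 2 * cos \<psi> \<noteq> 0"
    proof
      assume "2 * cos \<theta> + 2 * cos \<psi> = 0"
      hence "cos \<psi> = cos (pi-\<theta>)" by simp
      hence "\<psi> = pi-\<theta>" by (rule cos_inj_pi[rotated 4]) (use that \<theta> in auto)
      thus False using that by simp
    qed
    hence "norm (1 + cis (\<theta>+\<psi>)) \<noteq> 0" "norm (1 + cis (\<theta>-\<psi>)) \<noteq> 0"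
      using norm_prod[of \<psi>] by auto
    moreover have "norm (1 + cis \<phi>) = 0" if "cos \<phi> = -1" for \<phi>
    proof -
      have "sin \<phi> = 0" using that sin_cos_squared_add[of \<phi>] by simp
      thus ?thesis using that by (simp add: complex_eq_iff)
    qed
    ultimately show "cos (\<theta>+\<psi>) \<noteq> -1" "cos (\<theta>-\<psi>) \<noteq> -1" by metis+
  qed
  have lim: "(\<lambda>k. f k \<psi>) \<longlonglongrightarrow> g \<psi>" if \<psi>: "\<psi> \<in> {0..pi}" for \<psi>
  proof (cases "\<psi> = pi-\<theta>")
    case False
    have l: "(\<lambda>k. (1 + of_real (r k) * cis \<phi>) powr (-1/2)) \<longlonglongrightarrow> (1 + cis \<phi>) powr (-1/2)"
      if "cos \<phi> \<noteq> -1" for \<phi>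
    proof (rule tendsto_powr_complex[OF nz[OF that] _ tendsto_const])
      have "(\<lambda>k. 1 + of_real (r k) * cis \<phi>) \<longlonglongrightarrow> 1 + of_real 1 * cis \<phi>"
        by (intro tendsto_intros r)
      thus "(\<lambda>k. 1 + of_real (r k) * cis \<phi>) \<longlonglongrightarrow> 1 + cis \<phi>" by simp
    qed
    have "(\<lambda>k. f k \<psi>) \<longlonglongrightarrow> (1 + cis (\<theta>+\<psi>)) powr (-1/2) * (1 + cis (\<theta>-\<psi>)) powr (-1/2)"
      using tendsto_mult[OF l[OF cosne(1)[OF \<psi> False]] l[OF cosne(2)[OF \<psi> False]]] False
      by (simp add: f_def wcis)
    moreover have "(1 + cis (\<theta>+\<psi>)) powr (-1/2) * (1 + cis (\<theta>-\<psi>)) powr (-1/2) = g \<psi>"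
    proof -
      have m: "(1 + cis (\<theta>-\<psi>)) powr (-1/2) = of_real (1 / sqrt (2 * cos ((\<theta>-\<psi>)/2))) * cis (-(\<theta>-\<psi>)/4)"
        by (rule one_plus_cis_powr) (use \<psi> \<theta> in auto)
      have cc: "2 * cos \<theta> + 2 * cos \<psi> = (2 * cos ((\<theta>+\<psi>)/2)) * (2 * cos ((\<theta>-\<psi>)/2))"
        using cos_plus_cos[of \<theta> \<psi>] by simp
      have comb: "(a * b) * (c * d) = (b * d) * (a * c)" for a b c d :: complex by (simp add: mult_ac)
      show ?thesis
      proof (cases "\<psi> < pi-\<theta>")
        case True
        have p: "(1 + cis (\<theta>+\<psi>)) powr (-1/2) = of_real (1 / sqrt (2 * cos ((\<theta>+\<psi>)/2))) * cis (-(\<theta>+\<psi>)/4)"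
          by (rule one_plus_cis_powr) (use \<psi> \<theta> True in auto)
        have "-(\<theta>+\<psi>)/4 + -(\<theta>-\<psi>)/4 = -\<theta>/2" by (simp add: field_simps)
        hence "cis (-(\<theta>+\<psi>)/4) * cis (-(\<theta>-\<psi>)/4) = cis (-\<theta>/2)" by (simp only: cis_mult)
        moreover have "1 / sqrt (2 * cos ((\<theta>+\<psi>)/2)) * (1 / sqrt (2 * cos ((\<theta>-\<psi>)/2))) = B \<psi>"
        proof -
          have "B \<psi> = 1 / sqrt (2 * cos \<theta> + 2 * cos \<psi>)"
            unfolding B_def using pos[of \<psi>] \<psi> True by simp
          thus ?thesis unfolding cc real_sqrt_mult by simp
        qed
        hence "complex_of_real (1 / sqrt (2 * cos ((\<theta>+\<psi>)/2))) * of_real (1 / sqrt (2 * cos ((\<theta>-\<psi>)/2))) = of_real (B \<psi>)"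
          by (simp only: flip: of_real_mult)
        moreover have "g \<psi> = cis (-\<theta>/2) * of_real (B \<psi>)" using True by (simp add: g_def)
        ultimately show ?thesis unfolding p m by (simp only: comb)
      next
        case F: False
        \<comment> \<open>Here \<open>\<theta> + \<psi>\<close> has left \<open>(-\<pi>, \<pi>)\<close>; the reduction by \<open>2 \<pi>\<close> is what produces the factor \<open>\<i>\<close>.\<close>
        have "cis (\<theta>+\<psi>) = cis (\<theta>+\<psi>-2*pi)" by (simp add: complex_eq_iff cos_diff sin_diff)
        hence p: "(1 + cis (\<theta>+\<psi>)) powr (-1/2) =
            of_real (1 / sqrt (2 * cos ((\<theta>+\<psi>-2*pi)/2))) * cis (-(\<theta>+\<psi>-2*pi)/4)"
          using one_plus_cis_powr[of "\<theta>+\<psi>-2*pi"] \<psi> \<theta> F False by auto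
        have "-(\<theta>+\<psi>-2*pi)/4 + -(\<theta>-\<psi>)/4 = -\<theta>/2 + pi/2" by (simp add: field_simps)
        hence "cis (-(\<theta>+\<psi>-2*pi)/4) * cis (-(\<theta>-\<psi>)/4) = cis (-\<theta>/2) * cis (pi/2)" by (simp only: cis_mult)
        moreover have "1 / sqrt (2 * cos ((\<theta>+\<psi>-2*pi)/2)) * (1 / sqrt (2 * cos ((\<theta>-\<psi>)/2))) = B \<psi>"
        proof -
          have "cos ((\<theta>+\<psi>-2*pi)/2) = - cos ((\<theta>+\<psi>)/2)"
            by (simp add: diff_divide_distrib)
          moreover have "B \<psi> = 1 / sqrt (- (2 * cos \<theta> + 2 * cos \<psi>))"
            unfolding B_def using neg[of \<psi>] \<psi> F by (simp add: abs_of_nonpos)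
          ultimately show ?thesis unfolding cc by (simp flip: real_sqrt_mult)
        qed
        hence "complex_of_real (1 / sqrt (2 * cos ((\<theta>+\<psi>-2*pi)/2))) * of_real (1 / sqrt (2 * cos ((\<theta>-\<psi>)/2))) = of_real (B \<psi>)"
          by (simp only: flip: of_real_mult)
        moreover have "g \<psi> = (cis (-\<theta>/2) * cis (pi/2)) * of_real (B \<psi>)"
          using F False by (simp add: g_def)
        ultimately show ?thesis unfolding p m by (simp only: comb)
      qed
    qed
    ultimately show ?thesis by simp
  qed (simp add: f_def g_def)
  have bound: "norm (f k \<psi>) \<le> 2 * B \<psi>" if \<psi>: "\<psi> \<in> {0..pi}" for k \<psi>
  proof (cases "\<psi> = pi-\<theta>")
    case False
    have n: "norm (u powr (-1/2)) = 1 / sqrt (norm u)" if "u \<noteq> 0" for u :: complex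
      using that by (subst norm_powr_real_powr') (auto simp: powr_minus powr_half_sqrt divide_simps)
    have nz': "norm (1 + cis \<phi>) > 0" if "cos \<phi> \<noteq> -1" for \<phi>
      using nz[OF that] by auto
    have b: "norm ((1 + of_real (r k) * cis \<phi>) powr (-1/2)) \<le> sqrt 2 * (1 / sqrt (norm (1 + cis \<phi>)))"
      if "cos \<phi> \<noteq> -1" for \<phi>
    proof -
      have "1/2 * norm (1 + cis \<phi>) \<le> norm (1 + of_real (r k) * cis \<phi>)"
        using r(1,2)[of k] by (intro norm_one_plus_ge_half) auto
      moreover from this have "1 + of_real (r k) * cis \<phi> \<noteq> 0" using nz'[OF that] by auto
      ultimately have "norm ((1 + of_real (r k) * cis \<phi>) powr (-1/2)) \<le> 1 / sqrt (1/2 * norm (1 + cis \<phi>))"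
        using nz'[OF that] by (subst n) (auto intro!: divide_left_mono mult_pos_pos)
      also have "\<dots> = sqrt 2 * (1 / sqrt (norm (1 + cis \<phi>)))"
        by (simp add: real_sqrt_divide)
      finally show ?thesis .
    qed
    have "norm (f k \<psi>) \<le> (sqrt 2 * (1 / sqrt (norm (1 + cis (\<theta>+\<psi>))))) * (sqrt 2 * (1 / sqrt (norm (1 + cis (\<theta>-\<psi>)))))"
      using False mult_mono[OF b[OF cosne(1)[OF \<psi> False]] b[OF cosne(2)[OF \<psi> False]]]
      by (simp add: f_def wcis norm_mult)
    also have "\<dots> = (sqrt 2 * sqrt 2) * (1 / (sqrt (norm (1 + cis (\<theta>+\<psi>))) * sqrt (norm (1 + cis (\<theta>-\<psi>)))))"
      by simp
    also have "\<dots> = 2 * B \<psi>"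
      unfolding B_def norm_prod[symmetric] real_sqrt_mult by simp
    finally show ?thesis .
  qed (simp add: f_def B_def)
  have "(\<lambda>k. integral {0..pi} (f k)) \<longlonglongrightarrow> integral {0..pi} g"
  proof (rule dominated_convergence(2))
    show "f k integrable_on {0..pi}" for k using If[of k] by blast
    have "(B has_integral (pi/2 * ell_A ((cos (\<theta>/2))\<^sup>2) + pi/2 * ell_A ((sin (\<theta>/2))\<^sup>2))) {0..pi}"
      by (rule has_integral_combine[of 0 "pi-\<theta>" pi]) (use \<theta> B1 B2 in auto)
    hence "B integrable_on {0..pi}" by blast
    thus "(\<lambda>\<psi>. 2 * B \<psi>) integrable_on {0..pi}" by simp
  qed (use bound lim in auto)
  hence "(\<lambda>k. of_real pi * ell_A ((w k)\<^sup>2)) \<longlonglongrightarrow> (cis (-\<theta>/2) * (1 * of_real (pi/2 * ell_A ((cos (\<theta>/2))\<^sup>2))) +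
     cis (-\<theta>/2) * (\<i> * of_real (pi/2 * ell_A ((sin (\<theta>/2))\<^sup>2))))"
    using integral_unique[OF If] integral_unique[OF Ig] by simp
  also have "(cis (-\<theta>/2) * (1 * of_real (pi/2 * ell_A ((cos (\<theta>/2))\<^sup>2))) +
     cis (-\<theta>/2) * (\<i> * of_real (pi/2 * ell_A ((sin (\<theta>/2))\<^sup>2)))) =
     of_real pi * (cis (-\<theta>/2) * (of_real (ell_A ((cos (\<theta>/2))\<^sup>2)) + \<i> * of_real (ell_A ((sin (\<theta>/2))\<^sup>2))) / 2)"
    by (simp add: ring_distribs add_divide_distrib mult_ac)
  finally show ?thesis
    by (subst (asm) tendsto_mult_left_iff) (simp_all add: w_def)
qed

section \<open>The quotient \<open>D/A\<close> in the Koebe coordinate\<close>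

text \<open>Taylor coefficients of \<open>ln 4 - ln (sqrt (1 - x))\<close>.\<close>
definition ell_d :: "nat \<Rightarrow> real" where
  "ell_d n = (if n = 0 then ln 4 else 1 / (2 * real n))"

definition ell_A_fps :: "'a::real_normed_field fps" where
  "ell_A_fps = Abs_fps (\<lambda>n. of_real ((ell_W n)\<^sup>2))"

definition ell_D_fps :: "'a::real_normed_field fps" where
  "ell_D_fps = Abs_fps (\<lambda>n. of_real (ell_d n))"

definition ell_DA_fps :: "'a::real_normed_field fps" where
  "ell_DA_fps = ell_D_fps / ell_A_fps"

text \<open>The \<open>b\<^sub>n\<close> of the introduction. That they are the Taylor coefficients \<open>ell_b\<close> depends on the convergence of
the series and is proved as \<open>ell_b_eq\<close>.\<close>
abbreviation DA_coeff :: "nat \<Rightarrow> real" where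
  "DA_coeff n \<equiv> fps_nth ell_DA_fps n"

lemma ell_A_fps_0: "fps_nth ell_A_fps 0 = 1"
  by (simp add: ell_A_fps_def)

lemma ell_DA_A_fps: "ell_DA_fps * ell_A_fps = (ell_D_fps :: 'a::real_normed_field fps)"
proof -
  have "ell_D_fps / ell_A_fps = ell_D_fps * inverse (ell_A_fps :: 'a fps)"
    by (rule fps_divide_unit) (simp add: ell_A_fps_0)
  moreover have "inverse ell_A_fps * ell_A_fps = (1 :: 'a fps)"
    by (rule inverse_mult_eq_1) (simp add: ell_A_fps_0)
  ultimately show ?thesis by (simp add: ell_DA_fps_def mult.assoc)
qed

text \<open>The coefficients of \<open>D/A\<close> are real, although they are computed below from a complex circle integral.\<close>
lemma ell_DA_fps_of_real: "fps_nth ell_DA_fps n = (of_real (DA_coeff n) :: 'a::real_normed_field)"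
proof -
  define B :: "'a fps" where "B = Abs_fps (\<lambda>n. of_real (DA_coeff n))"
  have "B * ell_A_fps = ell_D_fps"
  proof (rule fps_ext)
    fix n
    have "fps_nth (B * ell_A_fps) n = of_real (fps_nth (ell_DA_fps * ell_A_fps) n)"
      by (simp add: B_def ell_A_fps_def fps_mult_nth)
    thus "fps_nth (B * ell_A_fps) n = fps_nth ell_D_fps n"
      unfolding ell_DA_A_fps by (simp add: ell_D_fps_def)
  qed
  hence "B * ell_A_fps = ell_DA_fps * ell_A_fps" by (simp add: ell_DA_A_fps)
  moreover have "ell_A_fps \<noteq> (0 :: 'a fps)" using ell_A_fps_0[where ?'a = 'a] by auto
  ultimately have "B = ell_DA_fps" by simp
  hence "fps_nth ell_DA_fps n = fps_nth B n" by (simp only:)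
  thus ?thesis by (simp add: B_def)
qed

lemma ell_A_has_fps_expansion:
  "(ell_A :: 'a \<Rightarrow> 'a::{real_normed_field,banach}) has_fps_expansion ell_A_fps"
proof (rule has_fps_expansionI)
  have "eventually (\<lambda>u::'a. u \<in> ball 0 1) (nhds 0)" by (intro eventually_nhds_in_open) auto
  thus "\<forall>\<^sub>F u in nhds (0::'a). (\<lambda>n. fps_nth ell_A_fps n * u ^ n) sums ell_A u"
    by eventually_elim (use ell_A_sums in \<open>auto simp: ell_A_fps_def\<close>)
qed

definition ell_D :: "complex \<Rightarrow> complex" where
  "ell_D z = of_real (ln 4) - Ln (1 - z) / 2"

lemma ell_D_sums:
  assumes "norm z < 1"
  shows "(\<lambda>n. of_real (ell_d n) * z ^ n) sums ell_D z"
proof -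
  have "(\<lambda>n. (-1) ^ Suc n / of_nat n * (-z) ^ n) sums Ln (1 + (-z))"
    by (rule Ln_series) (use assms in auto)
  hence "(\<lambda>n. (-1/2) * ((-1) ^ Suc n / of_nat n * (-z) ^ n)) sums ((-1/2) * Ln (1 - z))"
    by (intro sums_mult) simp
  moreover have "(-1/2) * ((-1) ^ Suc n / of_nat n * (-z) ^ n) = 1 / (2 * of_nat n) * z ^ n" for n
  proof -
    have "((-1::complex) ^ n * (-1) ^ n) = 1" by (simp flip: power_mult_distrib)
    thus ?thesis unfolding power_minus[of z] by (simp add: field_simps)
  qed
  ultimately have "(\<lambda>n. 1 / (2 * of_nat n) * z ^ n) sums ((-1/2) * Ln (1 - z))" by (simp only:)
  moreover have "(\<lambda>n. if n = 0 then of_real (ln 4) else 0) sums (of_real (ln 4) :: complex)"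
    using sums_single[of 0 "\<lambda>_. of_real (ln 4) :: complex"] by simp
  ultimately have "(\<lambda>n. 1 / (2 * of_nat n) * z ^ n + (if n = 0 then of_real (ln 4) else 0)) sums
      ((-1/2) * Ln (1 - z) + of_real (ln 4))" by (rule sums_add)
  moreover have "1 / (2 * of_nat n) * z ^ n + (if n = 0 then of_real (ln 4) else 0) = of_real (ell_d n) * z ^ n" for n
    by (simp add: ell_d_def)
  ultimately show ?thesis by (simp add: ell_D_def)
qed

lemma ell_D_has_fps_expansion: "ell_D has_fps_expansion ell_D_fps"
proof (rule has_fps_expansionI)
  have "eventually (\<lambda>u::complex. u \<in> ball 0 1) (nhds 0)" by (intro eventually_nhds_in_open) auto
  thus "\<forall>\<^sub>F u in nhds 0. (\<lambda>n. fps_nth ell_D_fps n * u ^ n) sums ell_D u"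
    by eventually_elim (use ell_D_sums in \<open>auto simp: ell_D_fps_def\<close>)
qed

definition koebe_fps :: "complex fps" where
  "koebe_fps = (4 * fps_X) * inverse ((1 + fps_X)\<^sup>2)"

lemma koebe_fps_expansion: "(\<lambda>w. 4 * w / (1 + w)\<^sup>2) has_fps_expansion koebe_fps"
proof -
  have "(\<lambda>w::complex. (4 * w) * inverse ((1 + w)\<^sup>2)) has_fps_expansion koebe_fps"
    unfolding koebe_fps_def power2_eq_square
    by (intro fps_expansion_intros) auto
  thus ?thesis by (simp add: divide_inverse)
qed

text \<open>The quotient \<open>D/A\<close> in the coordinate \<open>w\<close> of the Koebe map, written so that it makes sense on the whole unit
disc.\<close>
definition ell_G :: "complex \<Rightarrow> complex" where
  "ell_G w = (of_real (ln 4) + Ln (1 + w) - Ln (1 - w)) / ((1 + w) * ell_A (w\<^sup>2))"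

text \<open>Near \<open>0\<close> one has \<open>1 - z = ((1 - w) / (1 + w))\<^sup>2\<close> and Landen's transformation, so \<open>ell_G\<close> is
\<open>D/A\<close> in the Koebe coordinate.\<close>
lemma ell_G_eq: "\<forall>\<^sub>F w in nhds 0. ell_G w = ell_D (4 * w / (1 + w)\<^sup>2) / ell_A (4 * w / (1 + w)\<^sup>2)"
proof -
  define Y where "Y = (\<lambda>w. 2 * (Ln (1 - w) - Ln (1 + w)))"
  have "isCont Y 0" unfolding Y_def by (intro continuous_intros) auto
  hence "(Y \<longlongrightarrow> 0) (nhds 0)" by (simp add: isCont_def Y_def tendsto_nhds_iff)
  hence "\<forall>\<^sub>F w in nhds 0. norm (Y w) < 1" by (auto dest!: tendstoD[of _ _ _ 1])
  moreover have "eventually (\<lambda>u::complex. u \<in> ball 0 (1/8)) (nhds 0)" by (intro eventually_nhds_in_open) auto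
  ultimately show ?thesis
  proof eventually_elim
    case (elim w)
    hence w: "norm w < 1/8" by simp
    have nz: "1 + w \<noteq> 0" "1 - w \<noteq> 0"
      using w norm_diff_ineq[of 1 w] norm_diff_ineq[of 1 "-w"] by force+
    have "exp (Y w) = (exp (Ln (1 - w)) / exp (Ln (1 + w)))\<^sup>2"
      by (simp add: Y_def exp_double exp_diff power_divide mult.commute)
    also have "\<dots> = ((1 - w) / (1 + w))\<^sup>2" using nz by simp
    also have "\<dots> = 1 - 4 * w / (1 + w)\<^sup>2" using nz
      by (simp add: field_simps) (simp add: power2_eq_square algebra_simps)
    finally have e: "1 - 4 * w / (1 + w)\<^sup>2 = exp (Y w)" ..
    have "\<bar>Im (Y w)\<bar> < 1" using abs_Im_le_cmod[of "Y w"] elim by linarith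
    hence "Ln (exp (Y w)) = Y w" using pi_gt3 by (intro Ln_exp) auto
    hence "ell_D (4 * w / (1 + w)\<^sup>2) = of_real (ln 4) + Ln (1 + w) - Ln (1 - w)"
      by (simp add: ell_D_def e) (simp add: Y_def diff_divide_distrib)
    thus ?case using ell_A_landen[OF w] by (simp add: ell_G_def)
  qed
qed

lemma ell_G_fps_expansion: "ell_G has_fps_expansion fps_compose ell_DA_fps koebe_fps"
proof -
  have "(\<lambda>z. ell_D z / ell_A z) has_fps_expansion ell_DA_fps"
    unfolding ell_DA_fps_def
    by (intro has_fps_expansion_divide' ell_D_has_fps_expansion ell_A_has_fps_expansion)
       (simp add: ell_A_fps_0)
  hence "((\<lambda>z. ell_D z / ell_A z) \<circ> (\<lambda>w. 4 * w / (1 + w)\<^sup>2)) has_fps_expansion fps_compose ell_DA_fps koebe_fps"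
    by (rule has_fps_expansion_compose[OF _ koebe_fps_expansion]) (simp add: koebe_fps_def)
  thus ?thesis using ell_G_eq
    by (subst has_fps_expansion_cong) (auto simp: o_def)
qed

lemma one_plus_X_power_nth: "fps_nth ((1 + fps_X) ^ N) k = (of_nat (N choose k) :: complex)"
proof -
  have "(1 + fps_X) ^ N = (\<Sum>k\<le>N. of_nat (N choose k) * fps_X ^ k * 1 ^ (N - k) :: complex fps)"
    by (subst add.commute, rule binomial_ring)
  hence "fps_nth ((1 + fps_X) ^ N) k = (\<Sum>i\<le>N. fps_nth (of_nat (N choose i) * fps_X ^ i :: complex fps) k)"
    by (simp add: fps_sum_nth)
  also have "\<dots> = (\<Sum>i\<le>N. if i = k then of_nat (N choose k) else 0)"
    by (intro sum.cong) (auto simp: fps_of_nat[symmetric] fps_X_power_nth)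
  also have "\<dots> = of_nat (N choose k)" by (simp add: binomial_eq_0)
  finally show ?thesis .
qed

text \<open>Formally this is the change of variables in the residue of \<open>F(z) / z\<^sup>n\<^sup>+\<^sup>1\<close> at \<open>0\<close>. By linearity it is enough
to treat \<open>F = z\<^sup>m\<close>: for \<open>m < n\<close> the coefficient is a difference of two equal binomial coefficients, for
\<open>m = n\<close> it is \<open>4\<^sup>n\<close>, and for \<open>m > n\<close> it vanishes by order.\<close>
lemma koebe_lagrange:
  fixes F :: "complex fps"
  assumes n: "n \<ge> 1"
  shows "fps_nth (fps_compose F koebe_fps * ((1 - fps_X) * (1 + fps_X) ^ (2 * n - 1))) n = 4 ^ n * fps_nth F n"
proof -
  define U V :: "complex fps" where "U = 1 + fps_X" and "V = inverse U"
  define Q where "Q = (1 - fps_X) * U ^ (2 * n - 1)"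
  have UV: "V * U = 1" unfolding V_def by (rule inverse_mult_eq_1) (simp add: U_def)
  have Z: "koebe_fps = 4 * (fps_X * V ^ 2)"
    by (simp add: koebe_fps_def V_def U_def fps_inverse_power mult_ac)
  have Z0: "fps_nth koebe_fps 0 = 0" by (simp add: Z)
  have Zm: "koebe_fps ^ m = 4 ^ m * (fps_X ^ m * V ^ (2 * m))" for m
    by (simp add: Z power_mult_distrib power_mult)
  have num: "fps_nth (4 ^ m * G) k = 4 ^ m * fps_nth G k" for m k and G :: "complex fps"
    by (metis fps_const_mult_left fps_const_power fps_mult_left_const_nth numeral_fps_const)
  have low: "fps_nth (koebe_fps ^ m * Q) n = (if m = n then 4 ^ n else 0)" if m: "m \<le> n" for m
  proof (cases "m = n")
    case True
    have "U ^ (2 * n - 1) * U = U ^ (2 * n)" using n by (simp flip: power_Suc2)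
    hence "V ^ (2 * n) * U ^ (2 * n - 1) = V ^ (2 * n) * (U ^ (2 * n - 1) * U) * V"
    proof -
      have "V ^ (2 * n) * U ^ (2 * n - 1) = V ^ (2 * n) * U ^ (2 * n - 1) * (V * U)"
        by (simp only: UV mult_1_right)
      thus ?thesis by (simp only: mult_ac)
    qed
    also have "U ^ (2 * n - 1) * U = U ^ (2 * n)" by fact
    also have "V ^ (2 * n) * U ^ (2 * n) * V = V" by (simp flip: power_mult_distrib add: UV)
    finally have "koebe_fps ^ n * Q = 4 ^ n * (fps_X ^ n * ((1 - fps_X) * V))"
      by (simp add: Zm Q_def mult_ac)
    moreover have "fps_nth ((1 - fps_X) * V) 0 = 1" by (simp add: V_def U_def)
    ultimately show ?thesis using True by (simp add: num fps_X_power_mult_nth)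
  next
    case False
    define N where "N = n - m"
    have N: "N \<ge> 1" "2 * n - 1 = 2 * m + (2 * N - 1)" using m False by (auto simp: N_def)
    have "V ^ (2 * m) * U ^ (2 * n - 1) = (V ^ (2 * m) * U ^ (2 * m)) * U ^ (2 * N - 1)"
      unfolding N(2) power_add by (simp only: mult_ac)
    also have "\<dots> = U ^ (2 * N - 1)" by (simp flip: power_mult_distrib add: UV)
    finally have "koebe_fps ^ m * Q = 4 ^ m * (fps_X ^ m * ((1 - fps_X) * U ^ (2 * N - 1)))"
      by (simp add: Zm Q_def mult_ac)
    hence "fps_nth (koebe_fps ^ m * Q) n = 4 ^ m * fps_nth ((1 - fps_X) * U ^ (2 * N - 1)) N"
      using m by (simp add: num fps_X_power_mult_nth N_def)
    also have "fps_nth ((1 - fps_X) * U ^ (2 * N - 1)) N = of_nat ((2*N-1) choose N) - of_nat ((2*N-1) choose (N-1))"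
      using N unfolding U_def
      by (simp add: left_diff_distrib one_plus_X_power_nth)
    also have "(2*N-1) choose N = (2*N-1) choose (N-1)"
      using N binomial_symmetric[of N "2*N-1"] by simp
    finally show ?thesis using False by simp
  qed
  define T where "T = (\<Sum>m\<le>n. fps_const (fps_nth F m) * fps_X ^ m)"
  define R where "R = fps_shift (Suc n) F"
  have F: "F = T + fps_X ^ Suc n * R"
  proof (rule fps_ext)
    fix k
    have "fps_nth T k = (\<Sum>m\<le>n. fps_nth F m * (if k = m then 1 else 0))"
      by (simp add: T_def fps_sum_nth fps_X_power_nth)
    also have "\<dots> = (\<Sum>m\<le>n. if m = k then fps_nth F k else 0)"
      by (intro sum.cong) auto
    also have "\<dots> = (if k \<le> n then fps_nth F k else 0)" by simp
    finally show "fps_nth F k = fps_nth (T + fps_X ^ Suc n * R) k"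
      by (simp add: fps_X_power_mult_nth R_def del: power_Suc)
  qed
  have "fps_compose F koebe_fps = fps_compose T koebe_fps + koebe_fps ^ Suc n * fps_compose R koebe_fps"
    by (subst F) (simp add: fps_compose_add_distrib fps_compose_mult_distrib[OF Z0] fps_X_power_compose[OF Z0]
      fps_X_fps_compose_startby0[OF Z0] fps_compose_power[OF Z0, symmetric] Z0 del: power_Suc)
  also have "fps_compose T koebe_fps = (\<Sum>m\<le>n. fps_const (fps_nth F m) * koebe_fps ^ m)"
    unfolding T_def by (simp add: fps_compose_sum_distrib fps_compose_mult_distrib[OF Z0] fps_compose_power[OF Z0, symmetric]
       fps_X_fps_compose_startby0[OF Z0])
  finally have "fps_nth (fps_compose F koebe_fps * Q) n =
     (\<Sum>m\<le>n. fps_nth F m * fps_nth (koebe_fps ^ m * Q) n) + fps_nth (koebe_fps ^ Suc n * fps_compose R koebe_fps * Q) n"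
    by (simp add: distrib_right sum_distrib_right fps_sum_nth mult.assoc del: power_Suc)
  also have "koebe_fps ^ Suc n * fps_compose R koebe_fps * Q =
     fps_X ^ Suc n * (4 ^ Suc n * V ^ (2 * Suc n) * fps_compose R koebe_fps * Q)"
    unfolding Zm by (simp only: mult_ac)
  also have "fps_nth \<dots> n = 0" by (simp add: fps_X_power_mult_nth del: power_Suc)
  also have "(\<Sum>m\<le>n. fps_nth F m * fps_nth (koebe_fps ^ m * Q) n) = (\<Sum>m\<le>n. if m = n then 4 ^ n * fps_nth F n else 0)"
    by (intro sum.cong) (auto simp: low)
  finally show ?thesis by (simp add: Q_def U_def)
qed

section \<open>The coefficients of \<open>D/A\<close> as moments\<close>

text \<open>The function whose \<open>n\<close>-th Taylor coefficient is \<open>4\<^sup>n\<close> times the \<open>n\<close>-th coefficient of \<open>D/A\<close>, by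
\<open>koebe_lagrange\<close>.\<close>
definition ell_H :: "nat \<Rightarrow> complex \<Rightarrow> complex" where
  "ell_H n w = ell_G w * ((1 - w) * (1 + w) ^ (2 * n - 1))"

lemma unit_disc_facts:
  assumes "norm (w::complex) < 1"
  shows "1 + w \<notin> \<real>\<^sub>\<le>\<^sub>0" "1 - w \<notin> \<real>\<^sub>\<le>\<^sub>0" "1 + w \<noteq> 0" "1 - w \<noteq> 0" "norm (w\<^sup>2) < 1"
proof -
  have "\<bar>Re w\<bar> < 1" using abs_Re_le_cmod[of w] assms by linarith
  thus "1 + w \<notin> \<real>\<^sub>\<le>\<^sub>0" "1 - w \<notin> \<real>\<^sub>\<le>\<^sub>0" by (auto simp: complex_nonpos_Reals_iff)
  thus "1 + w \<noteq> 0" "1 - w \<noteq> 0" by auto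
  show "norm (w\<^sup>2) < 1" using assms by (simp add: norm_power power_less_one_iff)
qed

lemma ell_A_nonzero: "norm (z::complex) < 1 \<Longrightarrow> ell_A z \<noteq> 0"
  using Re_ell_A_ge[of z] by (metis divide_le_0_1_iff not_less real_sqrt_gt_0_iff zero_complex.simps(1) zero_less_numeral)

lemma ell_G_holomorphic: "ell_G holomorphic_on ball 0 1"
proof -
  have 2: "(ell_A \<circ> (\<lambda>w. w\<^sup>2)) holomorphic_on ball (0::complex) 1"
    by (rule holomorphic_on_compose_gen[OF _ ell_A_holomorphic])
       (auto intro!: holomorphic_intros simp: norm_power power_less_one_iff)
  show ?thesis unfolding ell_G_def
    by (intro holomorphic_intros) (use 2 unit_disc_facts ell_A_nonzero in \<open>auto simp: o_def\<close>)
qed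

lemma ell_H_sums:
  assumes "norm w < 1"
  shows "(\<lambda>k. (deriv ^^ k) (ell_H n) 0 / fact k * w ^ k) sums ell_H n w"
proof -
  have "ell_H n holomorphic_on ball 0 1"
    unfolding ell_H_def by (intro holomorphic_intros ell_G_holomorphic)
  from holomorphic_power_series[OF this, of w] show ?thesis using assms by simp
qed

lemma ell_H_coeff:
  assumes n: "n \<ge> 1"
  shows "(deriv ^^ n) (ell_H n) 0 / fact n = 4 ^ n * of_real (DA_coeff n)"
proof -
  have "ell_H n has_fps_expansion (fps_compose ell_DA_fps koebe_fps * ((1 - fps_X) * (1 + fps_X) ^ (2 * n - 1)))"
    unfolding ell_H_def by (intro fps_expansion_intros ell_G_fps_expansion)
  from fps_nth_fps_expansion[OF this, of n] show ?thesis
    by (simp only: koebe_lagrange[OF n] ell_DA_fps_of_real[where ?'a = complex])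
qed

lemma ell_G_cnj: "norm w < 1 \<Longrightarrow> ell_G (cnj w) = cnj (ell_G w)"
proof -
  assume w: "norm w < 1"
  have "Ln (1 + cnj w) = cnj (Ln (1 + w))" using cnj_Ln[OF unit_disc_facts(1)[OF w]] by simp
  moreover have "Ln (1 - cnj w) = cnj (Ln (1 - w))" using cnj_Ln[OF unit_disc_facts(2)[OF w]] by simp
  moreover have "ell_A ((cnj w)\<^sup>2) = cnj (ell_A (w\<^sup>2))" using ell_A_cnj[of "w\<^sup>2"] unit_disc_facts[OF w] by simp
  ultimately show ?thesis by (simp add: ell_G_def)
qed

text \<open>Cauchy's coefficient formula on the circle of radius \<open>r\<close>, folded to the upper half circle.\<close>
lemma DA_coeff_circle:
  assumes n: "n \<ge> 1" and r: "0 < r" "r < 1"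
  shows "((\<lambda>t. Re (ell_H n (of_real r * cis t) * cis (- (real n * t))) / (4 * r) ^ n)
            has_integral (pi * DA_coeff n)) {0..pi}"
proof -
  define F where "F = (\<lambda>t. ell_H n (of_real r * cis t) * cis (- (real n * t)))"
  have "(F has_integral (2 * pi * ((deriv ^^ n) (ell_H n) 0 / fact n) * (of_real r) ^ n)) {-pi..pi}"
    unfolding F_def by (rule power_series_fourier_coeff[OF ell_H_sums]) (use r in auto)
  hence "((\<lambda>t. F t + F (-t)) has_integral
      (complex_of_real (2 * pi) * (4 ^ n * complex_of_real (DA_coeff n)) * complex_of_real r ^ n)) {0..pi}"
    unfolding ell_H_coeff[OF n] by (rule has_integral_fold_symmetric) simp
  moreover have "F t + F (-t) = of_real (2 * Re (F t))" for t
  proof -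
    have "norm (of_real r * cis t) < 1" using r by (simp add: norm_mult)
    from ell_G_cnj[OF this] have "F (-t) = cnj (F t)"
      by (simp add: F_def ell_H_def cis_cnj)
    thus ?thesis by (simp add: complex_add_cnj)
  qed
  ultimately have "((\<lambda>t. complex_of_real (2 * Re (F t))) has_integral of_real (2 * pi * (4 * r) ^ n * DA_coeff n)) {0..pi}"
    by (simp add: power_mult_distrib mult_ac)
  from has_integral_linear[OF this bounded_linear_Re]
  have "((\<lambda>t. 2 * Re (F t)) has_integral (2 * pi * (4 * r) ^ n * DA_coeff n)) {0..pi}"
    by (simp only: o_def Re_complex_of_real)
  from has_integral_mult_right[OF this, of "1 / (2 * (4 * r) ^ n)"]
  have "((\<lambda>t. 1 / (2 * (4 * r) ^ n) * (2 * Re (F t))) has_integral (1 / (2 * (4 * r) ^ n) * (2 * pi * (4 * r) ^ n * DA_coeff n))) {0..pi}" .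
  moreover have "1 / (2 * (4 * r) ^ n) * (2 * pi * (4 * r) ^ n * DA_coeff n) = pi * DA_coeff n" using r by simp
  moreover have "1 / (2 * (4 * r) ^ n) * (2 * Re (F t)) = Re (F t) / (4 * r) ^ n" for t by simp
  ultimately show ?thesis by (simp only: F_def)
qed

lemma norm_mult_Ln_le:
  fixes u :: complex
  assumes "u \<noteq> 0" "norm u \<le> 2"
  shows "norm u * norm (Ln u) \<le> 2 + 2 * pi"
proof -
  define x where "x = norm u"
  have x: "0 < x" "x \<le> 2" using assms by (auto simp: x_def)
  have "Re (Ln u) = ln x" using assms by (simp add: x_def)
  moreover have "\<bar>Im (Ln u)\<bar> \<le> pi" using Im_Ln_le_pi[of u] mpi_less_Im_Ln[of u] assms by linarith
  ultimately have "norm (Ln u) \<le> \<bar>ln x\<bar> + pi" using cmod_le[of "Ln u"] by simp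
  hence "x * norm (Ln u) \<le> x * (\<bar>ln x\<bar> + pi)" using x by (intro mult_left_mono) auto
  also have "\<dots> = x * \<bar>ln x\<bar> + x * pi" by (simp add: algebra_simps)
  also have "x * pi \<le> 2 * pi" using x by simp
  also have "x * \<bar>ln x\<bar> \<le> 2"
  proof (cases "x \<le> 1")
    case True
    have "ln (1 / x) \<le> 1 / x - 1" using x by (intro ln_le_minus_one) auto
    hence "x * - ln x \<le> x * (1 / x - 1)" using x by (intro mult_left_mono) (auto simp: ln_div)
    also have "\<dots> \<le> 2" using x by (simp add: field_simps)
    finally show ?thesis using True x by (simp add: abs_of_nonpos)
  next
    case False
    have "ln x \<le> x - 1" using x by (intro ln_le_minus_one) auto
    hence "x * ln x \<le> 2 * 1" using x False by (intro mult_mono) auto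
    thus ?thesis using False by simp
  qed
  finally show ?thesis by (simp add: x_def)
qed

text \<open>One factor \<open>1 + w\<close> of \<open>ell_H\<close> cancels the denominator of \<open>ell_G\<close>. For \<open>n \<ge> 2\<close> another one is left, and
together with \<open>1 - w\<close> it compensates the logarithmic singularities at \<open>w = -1\<close> and \<open>w = 1\<close>.\<close>
lemma ell_H_bounded:
  assumes n: "n \<ge> 2" and w: "norm w < 1"
  shows "norm (ell_H n w) \<le> (4 * ln 4 + 8 + 8 * pi) * 2 ^ (2 * n - 3) * sqrt 2"
proof -
  note nz = unit_disc_facts[OF w]
  have le2: "norm (1 + w) \<le> 2" "norm (1 - w) \<le> 2"
    using norm_triangle_ineq[of 1 w] norm_triangle_ineq4[of 1 w] w by auto
  define D where "D = of_real (ln 4) + Ln (1 + w) - Ln (1 - w)"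
  have A: "norm (ell_A (w\<^sup>2)) \<ge> 1 / sqrt 2"
    using Re_ell_A_ge[OF nz(5)] complex_Re_le_cmod[of "ell_A (w\<^sup>2)"] by linarith
  have e: "2 * n - 1 = Suc (Suc (2 * n - 3))" using n by simp
  have H: "ell_H n w = (1 + w) ^ (2 * n - 3) * ((1 + w) * (1 - w) * D) / ell_A (w\<^sup>2)"
  proof -
    have "d / (p * a) * (q * (p * (p * y))) = y * (p * q * d) / a" if "p \<noteq> 0" for d p a q y :: complex
      using that by simp
    thus ?thesis unfolding ell_H_def ell_G_def D_def e power_Suc using nz(3) by blast
  qed
  have "norm ((1 + w) * (1 - w) * D) \<le> norm ((1 + w) * (1 - w)) * (ln 4 + norm (Ln (1 + w)) + norm (Ln (1 - w)))"
  proof -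
    have "norm D \<le> norm (complex_of_real (ln 4)) + norm (Ln (1 + w)) + norm (Ln (1 - w))"
      using norm_triangle_ineq[of "complex_of_real (ln 4)" "Ln (1 + w)"]
        norm_triangle_ineq4[of "complex_of_real (ln 4) + Ln (1 + w)" "Ln (1 - w)"]
      unfolding D_def by linarith
    also have "norm (complex_of_real (ln 4)) = ln 4" by (simp only: norm_of_real) simp
    finally show ?thesis unfolding norm_mult by (intro mult_left_mono) auto
  qed
  also have "\<dots> = norm (1 + w) * norm (1 - w) * ln 4 + norm (1 - w) * (norm (1 + w) * norm (Ln (1 + w)))
      + norm (1 + w) * (norm (1 - w) * norm (Ln (1 - w)))"
    unfolding norm_mult by (simp only: algebra_simps)
  also have "\<dots> \<le> 2 * 2 * ln 4 + 2 * (2 + 2 * pi) + 2 * (2 + 2 * pi)"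
    using le2 nz by (intro add_mono mult_mono mult_right_mono norm_mult_Ln_le) auto
  also have "\<dots> = 4 * ln 4 + 8 + 8 * pi" by simp
  finally have 1: "norm ((1 + w) * (1 - w) * D) \<le> 4 * ln 4 + 8 + 8 * pi" .
  have 2: "norm (1 + w) ^ (2 * n - 3) \<le> 2 ^ (2 * n - 3)" using le2 by (intro power_mono) auto
  have "norm (ell_H n w) = norm (1 + w) ^ (2 * n - 3) * norm ((1 + w) * (1 - w) * D) * (1 / norm (ell_A (w\<^sup>2)))"
    by (simp add: H norm_mult norm_divide norm_power)
  also have "\<dots> \<le> 2 ^ (2 * n - 3) * (4 * ln 4 + 8 + 8 * pi) * sqrt 2"
  proof (intro mult_mono 1 2)
    have "1 / norm (ell_A (w\<^sup>2)) \<le> 1 / (1 / sqrt 2)" using A by (intro divide_left_mono) (auto intro!: mult_pos_pos simp: nz ell_A_nonzero)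
    thus "1 / norm (ell_A (w\<^sup>2)) \<le> sqrt 2" by simp
  qed (auto intro!: mult_nonneg_nonneg add_nonneg_nonneg)
  finally show ?thesis by (simp add: mult_ac)
qed

text \<open>With \<open>k = sin (t/2)\<close>, the numerator is \<open>K(k') - ln (4 k'/k) 2/\<pi> K(k)\<close> times \<open>k\<close>: up to positive
factors, the jump of \<open>D/A\<close> across the cut at \<open>1 / cos\<^sup>2(t/2)\<close>.\<close>
definition boundary_density :: "real \<Rightarrow> real" where
  "boundary_density t = (let P = ell_A ((cos (t/2))\<^sup>2); Q = ell_A ((sin (t/2))\<^sup>2) in
      sin (t/2) * (pi / 2 * P - ln (4 * cos (t/2) / sin (t/2)) * Q) / (P\<^sup>2 + Q\<^sup>2))"

text \<open>This is \<open>ell_A_ratio_gt_ln\<close> at \<open>y = sin\<^sup>2(t/2)\<close>.\<close>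
lemma boundary_density_nonneg:
  assumes t: "0 < t" "t < pi"
  shows "boundary_density t \<ge> 0"
proof -
  define c s where "c = cos (t/2)" and "s = sin (t/2)"
  have cs: "c > 0" "s > 0" using t by (auto simp: c_def s_def intro!: cos_gt_zero sin_gt_zero)
  have c2: "c\<^sup>2 = 1 - s\<^sup>2" by (simp add: c_def s_def cos_squared_eq)
  have s2: "0 < s\<^sup>2" "s\<^sup>2 < 1" using cs c2 zero_less_power[of c 2] by auto
  have "ln (16 * (1 - s\<^sup>2) / s\<^sup>2) = ln ((4 * c / s)\<^sup>2)"
    using c2 by (simp add: power_divide power_mult_distrib)
  also have "\<dots> = 2 * ln (4 * c / s)" using cs by (subst ln_realpow) auto
  finally have "ln (4 * c / s) * ell_A (s\<^sup>2) < pi / 2 * ell_A (c\<^sup>2)"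
    using ell_A_ratio_gt_ln[OF s2] by (simp add: c2)
  thus ?thesis unfolding boundary_density_def Let_def c_def[symmetric] s_def[symmetric]
    using cs by (intro divide_nonneg_nonneg mult_nonneg_nonneg) auto
qed

text \<open>At \<open>w = cis t\<close> the numerator of \<open>ell_G\<close> is \<open>ln (4 cos (t/2) / sin (t/2)) + \<i> \<pi>/2\<close> and the value of \<open>A\<close> is
given by \<open>ell_A_boundary\<close>. The powers of \<open>cis (t/2)\<close> cancel, which leaves a multiple of the imaginary part of
a quotient.\<close>
lemma ell_H_boundary:
  assumes n: "n \<ge> 2" and t: "0 < t" "t < pi"
    and r: "\<And>k. 0 < r k" "\<And>k. r k < 1" "r \<longlonglongrightarrow> 1"
  shows "(\<lambda>k. Re (ell_H n (of_real (r k) * cis t) * cis (- (real n * t))) / (4 * r k) ^ n)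
     \<longlonglongrightarrow> boundary_density t * cos (t/2) ^ (2 * n - 2)"
proof -
  define c s where "c = cos (t/2)" and "s = sin (t/2)"
  have cs: "c > 0" "s > 0" using t by (auto simp: c_def s_def intro!: cos_gt_zero sin_gt_zero)
  define P Q where "P = ell_A (c\<^sup>2)" and "Q = ell_A (s\<^sup>2)"
  have c2: "c\<^sup>2 = 1 - s\<^sup>2" by (simp add: c_def s_def cos_squared_eq)
  have "0 < c\<^sup>2" "0 < s\<^sup>2" using cs by auto
  hence P1: "P \<ge> 1" using ell_A_ge_1[of "c\<^sup>2"] c2 by (simp add: P_def)
  define \<omega> where "\<omega> = cis (t/2)"
  define w where "w = (\<lambda>k. of_real (r k) * cis t)"
  have wn: "norm (w k) < 1" for k using r(1)[of k] r(2)[of k] by (simp add: w_def norm_mult)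
  have wl: "w \<longlonglongrightarrow> cis t"
    using tendsto_mult[OF tendsto_of_real[OF r(3)] tendsto_const[of "cis t"]] by (simp add: w_def)
  have p1: "1 + cis t = of_real (2 * c) * \<omega>" using one_plus_cis_eq[of t] by (simp add: c_def \<omega>_def)
  have p2: "1 - cis t = of_real (2 * s) * cis (t/2 - pi/2)"
  proof -
    have "1 - cos t = 2 * (s * s)" using cos_double_sin[of "t/2"] by (simp add: s_def power2_eq_square)
    moreover have "sin t = 2 * s * c" using sin_double[of "t/2"] by (simp add: s_def c_def)
    moreover have "cis (t/2 - pi/2) = Complex s (-c)"
      by (simp add: complex_eq_iff cos_diff sin_diff s_def c_def)
    ultimately show ?thesis by (simp add: complex_eq_iff)
  qed
  have p2': "1 - cis t = of_real (2 * s) * (- \<i> * \<omega>)"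
    unfolding p2 by (simp add: complex_eq_iff cos_diff sin_diff \<omega>_def)
  have lnp: "Ln (of_real \<rho> * cis \<alpha>) = of_real (ln \<rho>) + \<i> * of_real \<alpha>"
    if "\<rho> > 0" "-pi < \<alpha>" "\<alpha> \<le> pi" for \<rho> \<alpha>
  proof -
    have "of_real \<rho> * cis \<alpha> = exp (of_real (ln \<rho>) + \<i> * of_real \<alpha>)"
      using that by (simp add: exp_add cis_conv_exp exp_of_real)
    thus ?thesis using that by (simp only:) (rule Ln_exp, auto)
  qed
  have L1: "Ln (1 + cis t) = of_real (ln (2 * c)) + \<i> * of_real (t/2)"
    unfolding p1 \<omega>_def by (rule lnp) (use cs t in auto)
  have L2: "Ln (1 - cis t) = of_real (ln (2 * s)) + \<i> * of_real (t/2 - pi/2)"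
    unfolding p2 by (rule lnp) (use cs t in auto)
  have Re1: "\<bar>cos t\<bar> < 1"
  proof -
    have "sin t > 0" using t by (intro sin_gt_zero) auto
    hence "(cos t)\<^sup>2 < 1" by (simp add: cos_squared_eq)
    thus ?thesis by (simp add: abs_square_less_1)
  qed
  have nn: "1 + cis t \<notin> \<real>\<^sub>\<le>\<^sub>0" "1 - cis t \<notin> \<real>\<^sub>\<le>\<^sub>0"
    using Re1 by (auto simp: complex_nonpos_Reals_iff)
  define D where "D = (\<lambda>w. of_real (ln 4) + Ln (1 + w) - Ln (1 - w))"
  define L where "L = ln (4 * c / s)"
  have Dlim: "(\<lambda>k. D (w k)) \<longlonglongrightarrow> of_real L + \<i> * of_real (pi/2)"
  proof -
    have "(\<lambda>k. D (w k)) \<longlonglongrightarrow> D (cis t)"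
      unfolding D_def by (intro tendsto_intros wl nn)
    also have "D (cis t) = of_real (ln 4 + ln (2 * c) - ln (2 * s)) + \<i> * of_real (pi/2)"
      unfolding D_def L1 L2 by (simp add: algebra_simps)
    also have "ln 4 + ln (2 * c) - ln (2 * s) = L"
      using cs by (simp add: L_def ln_mult ln_div)
    finally show ?thesis .
  qed
  have Alim: "(\<lambda>k. ell_A ((w k)\<^sup>2)) \<longlonglongrightarrow> inverse \<omega> * (of_real P + \<i> * of_real Q) / 2"
    using ell_A_boundary[OF t r] unfolding w_def P_def Q_def c_def s_def \<omega>_def
    by (simp add: cis_inverse)
  have \<omega>0: "\<omega> \<noteq> 0" by (simp add: \<omega>_def)
  have PQ: "of_real P + \<i> * of_real Q \<noteq> (0::complex)" using P1 by (auto simp: complex_eq_iff)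
  have e: "2 * n - 1 = Suc (2 * n - 2)" using n by simp
  have H: "ell_H n (w k) = (1 + w k) ^ (2 * n - 2) * (1 - w k) * D (w k) / ell_A ((w k)\<^sup>2)" for k
  proof -
    have "d / (p * a) * (q * (p * y)) = y * q * d / a" if "p \<noteq> 0" for d p a q y :: complex
      using that by simp
    thus ?thesis unfolding ell_H_def ell_G_def D_def e power_Suc using unit_disc_facts(3)[OF wn[of k]] by blast
  qed
  have "(\<lambda>k. ell_H n (w k) * cis (- (real n * t))) \<longlonglongrightarrow>
     (1 + cis t) ^ (2 * n - 2) * (1 - cis t) * (of_real L + \<i> * of_real (pi/2)) /
       (inverse \<omega> * (of_real P + \<i> * of_real Q) / 2) * cis (- (real n * t))"
    unfolding H by (intro tendsto_intros wl Dlim Alim) (use \<omega>0 PQ in auto)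
  also have "(1 + cis t) ^ (2 * n - 2) * (1 - cis t) * (of_real L + \<i> * of_real (pi/2)) /
       (inverse \<omega> * (of_real P + \<i> * of_real Q) / 2) * cis (- (real n * t)) =
     of_real (4 * s * (2 * c) ^ (2 * n - 2)) * ((- \<i>) * (of_real L + \<i> * of_real (pi/2)) / (of_real P + \<i> * of_real Q))"
  proof -
    have "\<omega> ^ (2 * n) = cis (real n * t)" by (simp add: \<omega>_def Complex.DeMoivre)
    hence cis: "cis (- (real n * t)) = inverse (\<omega> ^ (2 * n))" by (simp add: cis_inverse)
    have split: "\<omega> ^ (2 * n) = \<omega> ^ (2 * n - 2) * \<omega> * \<omega>"
    proof -
      have "2 * n = Suc (Suc (2 * n - 2))" using n by simp
      thus ?thesis by (metis power_Suc2)
    qed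
    have ph: "\<omega> ^ (2 * n - 2) * \<omega> * \<omega> * inverse (\<omega> ^ (2 * n)) = 1"
      unfolding split[symmetric] using \<omega>0 by simp
    have alg: "(of_real (2 * c) * o1) ^ m * (of_real (2 * s) * (- \<i> * o1)) * X / (inverse o1 * Y / 2) * z =
       (o1 ^ m * o1 * o1 * z) * (of_real (4 * s * (2 * c) ^ m) * ((- \<i>) * X / Y))"
      if "o1 \<noteq> 0" "Y \<noteq> 0" for o1 X Y z m
      using that by (simp add: field_simps power_mult_distrib)
    show ?thesis unfolding p1 p2' cis using alg[OF \<omega>0 PQ] ph by simp
  qed
  finally have "(\<lambda>k. Re (ell_H n (w k) * cis (- (real n * t)))) \<longlonglongrightarrow>
     Re (of_real (4 * s * (2 * c) ^ (2 * n - 2)) * ((- \<i>) * (of_real L + \<i> * of_real (pi/2)) / (of_real P + \<i> * of_real Q)))"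
    by (rule tendsto_Re)
  also have "Re (of_real (4 * s * (2 * c) ^ (2 * n - 2)) * ((- \<i>) * (of_real L + \<i> * of_real (pi/2)) / (of_real P + \<i> * of_real Q))) =
     4 * s * (2 * c) ^ (2 * n - 2) * ((pi / 2 * P - L * Q) / (P\<^sup>2 + Q\<^sup>2))"
  proof -
    have "Re (of_real x * z) = x * Re z" for x z by simp
    moreover have "Re ((- \<i>) * (of_real L + \<i> * of_real (pi/2)) / (of_real P + \<i> * of_real Q)) =
       (pi / 2 * P - L * Q) / (P\<^sup>2 + Q\<^sup>2)" by (simp add: Re_divide) (simp add: diff_divide_distrib)
    ultimately show ?thesis by (simp only:)
  qed
  finally have "(\<lambda>k. Re (ell_H n (w k) * cis (- (real n * t)))) \<longlonglongrightarrow>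
     4 * s * (2 * c) ^ (2 * n - 2) * ((pi / 2 * P - L * Q) / (P\<^sup>2 + Q\<^sup>2))" .
  moreover have "(\<lambda>k. (4 * r k) ^ n) \<longlonglongrightarrow> (4 * 1) ^ n" by (intro tendsto_intros r)
  ultimately have "(\<lambda>k. Re (ell_H n (w k) * cis (- (real n * t))) / (4 * r k) ^ n) \<longlonglongrightarrow>
     4 * s * (2 * c) ^ (2 * n - 2) * ((pi / 2 * P - L * Q) / (P\<^sup>2 + Q\<^sup>2)) / (4 * 1) ^ n"
    by (rule tendsto_divide) auto
  also have "4 * s * (2 * c) ^ (2 * n - 2) * ((pi / 2 * P - L * Q) / (P\<^sup>2 + Q\<^sup>2)) / (4 * 1) ^ n =
     boundary_density t * c ^ (2 * n - 2)"
  proof -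
    have "(4::real) ^ n = 4 * 2 ^ (2 * n - 2)"
    proof -
      have "(4::real) ^ n = 2 ^ (2 * n)" by (simp add: power_mult)
      also have "2 * n = (2 * n - 2) + 2" using n by simp
      also have "(2::real) ^ \<dots> = 4 * 2 ^ (2 * n - 2)" unfolding power_add by simp
      finally show ?thesis .
    qed
    thus ?thesis
      unfolding boundary_density_def Let_def c_def[symmetric] s_def[symmetric] P_def[symmetric] Q_def[symmetric] L_def[symmetric]
      by (simp add: power_mult_distrib)
  qed
  finally show ?thesis by (simp only: w_def c_def)
qed

text \<open>The change of variable \<open>s = cos\<^sup>2(t/2)\<close> would make this a Hausdorff moment representation on \<open>[0, 1]\<close>, so
monotonicity and log-convexity follow at once.\<close>
lemma DA_coeff_moment:
  assumes n: "n \<ge> 2"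
  shows "((\<lambda>t. boundary_density t * cos (t/2) ^ (2 * n - 2)) has_integral (pi * DA_coeff n)) {0<..<pi}"
proof -
  define r where "r = (\<lambda>k::nat. 1 - 1 / (real k + 2))"
  have r: "0 < r k" "r k < 1" "1/2 \<le> r k" for k by (auto simp: r_def field_simps)
  have rl: "r \<longlonglongrightarrow> 1" unfolding r_def by real_asymp
  define K where "K = (4 * ln 4 + 8 + 8 * pi) * 2 ^ (2 * n - 3) * sqrt 2"
  show ?thesis
  proof (rule has_integral_dominated_convergence)
    fix k
    show "((\<lambda>t. Re (ell_H n (of_real (r k) * cis t) * cis (- (real n * t))) / (4 * r k) ^ n)
            has_integral (pi * DA_coeff n)) {0<..<pi}"
      using DA_coeff_circle[of n "r k"] n r[of k] by (simp add: has_integral_Icc_iff_Ioo)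
    show "\<forall>t\<in>{0<..<pi}. norm (Re (ell_H n (of_real (r k) * cis t) * cis (- (real n * t))) / (4 * r k) ^ n) \<le> K"
    proof
      fix t
      have "\<bar>Re (ell_H n (of_real (r k) * cis t) * cis (- (real n * t)))\<bar> \<le> norm (ell_H n (of_real (r k) * cis t))"
        by (metis abs_Re_le_cmod mult.right_neutral norm_cis norm_mult)
      also have "\<dots> \<le> K" unfolding K_def
        by (rule ell_H_bounded[OF n]) (use r[of k] in \<open>auto simp: norm_mult\<close>)
      finally have *: "\<bar>Re (ell_H n (of_real (r k) * cis t) * cis (- (real n * t)))\<bar> \<le> K" .
      have "1 \<le> (4 * r k) ^ n" using r[of k] by (intro one_le_power) auto
      hence "\<bar>Re (ell_H n (of_real (r k) * cis t) * cis (- (real n * t)))\<bar> / (4 * r k) ^ n \<le>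
           \<bar>Re (ell_H n (of_real (r k) * cis t) * cis (- (real n * t)))\<bar> / 1"
        by (intro divide_left_mono) auto
      thus "norm (Re (ell_H n (of_real (r k) * cis t) * cis (- (real n * t))) / (4 * r k) ^ n) \<le> K"
        using * r[of k] by (simp add: abs_divide)
    qed
  next
    show "(\<lambda>_. K) integrable_on {0<..<pi}"
      by (simp add: integrable_on_Icc_iff_Ioo[symmetric] integrable_const_ivl)
    show "\<forall>t\<in>{0<..<pi}. (\<lambda>k. Re (ell_H n (of_real (r k) * cis t) * cis (- (real n * t))) / (4 * r k) ^ n)
       \<longlonglongrightarrow> boundary_density t * cos (t/2) ^ (2 * n - 2)"
      using ell_H_boundary[OF n _ _ r(1,2) rl] by auto
  qed auto
qed

lemma DA_coeff_decreasing:
  assumes n: "n \<ge> 2"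
  shows "DA_coeff (Suc n) \<le> DA_coeff n"
proof -
  have "pi * DA_coeff (Suc n) \<le> pi * DA_coeff n"
  proof (rule has_integral_le[OF DA_coeff_moment DA_coeff_moment])
    fix t assume t: "t \<in> {0<..<pi}"
    have "cos (t/2) \<ge> 0" using t by (intro cos_ge_zero) auto
    hence "cos (t/2) ^ (2 * Suc n - 2) \<le> cos (t/2) ^ (2 * n - 2)"
      by (intro power_decreasing) auto
    thus "boundary_density t * cos (t/2) ^ (2 * Suc n - 2) \<le> boundary_density t * cos (t/2) ^ (2 * n - 2)"
      using boundary_density_nonneg[of t] t by (intro mult_left_mono) auto
  qed (use n in auto)
  thus ?thesis by simp
qed

text \<open>The form is the integral of \<open>(\<alpha> - cos\<^sup>2(t/2))\<^sup>2\<close> against a nonnegative density.\<close>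
lemma DA_coeff_quadratic_form_nonneg:
  assumes n: "n \<ge> 2"
  shows "\<alpha>\<^sup>2 * DA_coeff n - 2 * \<alpha> * DA_coeff (n + 1) + DA_coeff (n + 2) \<ge> 0"
proof -
  define M where "M = (\<lambda>n t. boundary_density t * cos (t/2) ^ (2 * n - 2))"
  have I: "(M n has_integral (pi * DA_coeff n)) {0<..<pi}" if "n \<ge> 2" for n
    using DA_coeff_moment[OF that] by (simp add: M_def)
  have "((\<lambda>t. \<alpha>\<^sup>2 * M n t - 2 * \<alpha> * M (n + 1) t + M (n + 2) t) has_integral
     (\<alpha>\<^sup>2 * (pi * DA_coeff n) - 2 * \<alpha> * (pi * DA_coeff (n + 1)) + pi * DA_coeff (n + 2))) {0<..<pi}"
    by (intro has_integral_add has_integral_diff has_integral_mult_right I) (use n in auto)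
  moreover have "\<alpha>\<^sup>2 * M n t - 2 * \<alpha> * M (n + 1) t + M (n + 2) t \<ge> 0" if "t \<in> {0<..<pi}" for t
  proof -
    define m where "m = 2 * n - 2"
    have e: "2 * (n + 1) - 2 = m + 2" "2 * (n + 2) - 2 = m + 4" using n by (auto simp: m_def)
    have "\<alpha>\<^sup>2 * M n t - 2 * \<alpha> * M (n + 1) t + M (n + 2) t =
       boundary_density t * cos (t/2) ^ m * (\<alpha> - (cos (t/2))\<^sup>2)\<^sup>2"
      unfolding M_def e m_def[symmetric] by (simp add: power_add) (simp add: power2_eq_square algebra_simps numeral_eq_Suc)
    also have "\<dots> \<ge> 0"
      using that by (intro mult_nonneg_nonneg[OF mult_nonneg_nonneg zero_le_power2] boundary_density_nonneg zero_le_power cos_ge_zero) auto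
    finally show ?thesis .
  qed
  ultimately have "0 \<le> \<alpha>\<^sup>2 * (pi * DA_coeff n) - 2 * \<alpha> * (pi * DA_coeff (n + 1)) + pi * DA_coeff (n + 2)"
    by (rule has_integral_nonneg)
  also have "\<dots> = pi * (\<alpha>\<^sup>2 * DA_coeff n - 2 * \<alpha> * DA_coeff (n + 1) + DA_coeff (n + 2))" by (simp add: algebra_simps)
  finally show ?thesis using pi_gt_zero by (simp add: zero_le_mult_iff)
qed

section \<open>Signs of the coefficients\<close>

text \<open>Put \<open>r\<^sub>n = b\<^sub>n / b\<^sub>n\<^sub>-\<^sub>1\<close>. Subtracting \<open>r\<^sub>n\<close> times the convolution identity for \<open>n - 1\<close> from the one for \<open>n\<close>
eliminates \<open>a\<^sub>0\<close> and gives \<open>b\<^sub>0 a\<^sub>n = \<Sum>k=1..n-1. w\<^sub>k a\<^sub>k\<close> with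
\<open>w\<^sub>k = b\<^sub>n\<^sub>-\<^sub>1\<^sub>-\<^sub>k (r\<^sub>n - r\<^sub>n\<^sub>-\<^sub>k)\<close>. The \<open>r\<^sub>n\<close> increase from \<open>n = 2\<close> on, and \<open>r\<^sub>1 < r\<^sub>3\<close>, so for
\<open>n \<ge> 5\<close> all weights are nonnegative. The only term that may be positive is \<open>w\<^sub>2 a\<^sub>2\<close>; it is absorbed by
\<open>w\<^sub>3 a\<^sub>3\<close>, since \<open>w\<^sub>2 \<le> w\<^sub>3\<close>.\<close>
lemma kaluza_variant:
  fixes a b :: "nat \<Rightarrow> real"
  assumes conv: "\<And>n. n \<ge> 1 \<Longrightarrow> (\<Sum>k\<le>n. a k * b (n - k)) = 0"
    and bpos: "\<And>n. b n > 0"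
    and mono: "\<And>n. n \<ge> 1 \<Longrightarrow> b (Suc n) \<le> b n"
    and logconv: "\<And>n. n \<ge> 1 \<Longrightarrow> (b (n + 1))\<^sup>2 \<le> b n * b (n + 2)"
    and r13: "b 1 / b 0 < b 3 / b 2"
    and a: "a 1 < 0" "a 2 \<le> - a 3" "a 3 < 0" "a 4 < 0"
    and n: "n \<ge> 3"
  shows "a n < 0"
  using n
proof (induction n rule: less_induct)
  case (less n)
  consider "n = 3" | "n = 4" | "n \<ge> 5" using less.prems by linarith
  thus ?case
  proof cases
    case n5: 3
    define r where "r = (\<lambda>n. b n / b (n - 1))"
    have br: "b n = r n * b (n - 1)" for n using bpos[of "n - 1"] by (simp add: r_def)
    have r_Suc: "r n \<le> r (Suc n)" if "n \<ge> 2" for n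
    proof -
      have "(b (n - 1 + 1))\<^sup>2 \<le> b (n - 1) * b (n - 1 + 2)" by (rule logconv) (use that in auto)
      hence "(b n)\<^sup>2 \<le> b (n - 1) * b (Suc n)" using that by (simp add: numeral_2_eq_2)
      thus ?thesis using bpos[of n] bpos[of "n - 1"] by (simp add: r_def field_simps power2_eq_square)
    qed
    have r_mono: "r i \<le> r j" if "2 \<le> i" "i \<le> j" for i j
      using that(2,1) by (induction j rule: dec_induct) (auto intro: order_trans r_Suc)
    have r1: "r 1 < r j" if "3 \<le> j" for j
      using r_mono[of 3 j] that r13 by (simp add: r_def)
    have r_le: "r i \<le> r n" if "1 \<le> i" "i \<le> n" for i
      using r_mono[of i n] r1[of n] that n5 by (cases "i = 1") auto
    define w where "w = (\<lambda>k. b (n - 1 - k) * (r n - r (n - k)))"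
    have w_nonneg: "w k \<ge> 0" if "k \<le> n - 1" for k
      unfolding w_def using bpos[of "n - 1 - k"] r_le[of "n - k"] that n5 by (intro mult_nonneg_nonneg) auto
    have w_eq: "w k = r n * b (n - 1 - k) - b (n - k)" for k
      using br[of "n - k"] by (simp add: w_def algebra_simps)
    have "b 0 * a n = (\<Sum>k=1..n-1. w k * a k)"
    proof -
      have 1: "(\<Sum>k\<le>n-1. a k * b (n - k)) + a n * b 0 = 0"
        using conv[of n] n5 by (cases n) auto
      have 2: "(\<Sum>k\<le>n-1. a k * b (n - 1 - k)) = 0" using conv[of "n - 1"] n5 by simp
      have "(\<Sum>k\<le>n-1. w k * a k) = r n * (\<Sum>k\<le>n-1. a k * b (n - 1 - k)) - (\<Sum>k\<le>n-1. a k * b (n - k))"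
        unfolding w_eq sum_distrib_left sum_subtractf[symmetric] by (intro sum.cong) (auto simp: algebra_simps)
      hence "(\<Sum>k\<le>n-1. w k * a k) = b 0 * a n" using 1 2 by (simp add: algebra_simps)
      moreover have "w 0 = 0" by (simp add: w_def)
      moreover have "{..n-1} = insert 0 {1..n-1}" by auto
      ultimately show ?thesis by simp
    qed
    \<comment> \<open>The last term is separated because it supplies strictness: its weight is \<open>b\<^sub>0 (r\<^sub>n - r\<^sub>1) > 0\<close>.\<close>
    also have "{1..n-1} = {1,2,3} \<union> {4..<n-1} \<union> {n-1}" using n5 by auto
    also have "(\<Sum>k\<in>\<dots>. w k * a k) = w 1 * a 1 + (w 2 * a 2 + w 3 * a 3) + (\<Sum>k=4..<n-1. w k * a k) + w (n-1) * a (n-1)"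
      using n5 by (subst sum.union_disjoint; force)+
    also have "\<dots> < 0"
    proof -
      have "w 1 * a 1 \<le> 0" using w_nonneg[of 1] a n5 by (intro mult_nonneg_nonpos) auto
      moreover have "w 2 * a 2 + w 3 * a 3 \<le> 0"
      proof -
        have "w 2 \<le> w 3" unfolding w_def
        proof (intro mult_mono)
          have "Suc (n - 1 - 3) = n - 1 - 2" using n5 by simp
          thus "b (n - 1 - 2) \<le> b (n - 1 - 3)" using mono[of "n - 1 - 3"] n5 by simp
          have "Suc (n - 3) = n - 2" using n5 by simp
          thus "r n - r (n - 2) \<le> r n - r (n - 3)" using r_Suc[of "n - 3"] n5 by simp
          show "0 \<le> r n - r (n - 2)" using r_le[of "n - 2"] n5 by simp
        qed (use bpos[of "n - 1 - 3"] in auto)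
        hence "w 3 * a 3 \<le> w 2 * a 3" using a by (intro mult_right_mono_neg) auto
        moreover have "w 2 * a 2 \<le> w 2 * (- a 3)" using w_nonneg[of 2] a n5 by (intro mult_left_mono) auto
        ultimately show ?thesis by simp
      qed
      moreover have "(\<Sum>k=4..<n-1. w k * a k) \<le> 0"
      proof (intro sum_nonpos)
        fix k assume k: "k \<in> {4..<n-1}"
        have "a k < 0" using k by (intro less.IH) auto
        thus "w k * a k \<le> 0" using w_nonneg[of k] k by (intro mult_nonneg_nonpos) auto
      qed
      moreover have "w (n-1) * a (n-1) < 0"
      proof (rule mult_pos_neg)
        have "n - (n - 1) = 1" using n5 by simp
        thus "w (n-1) > 0" using bpos[of 0] r1[of n] n5 by (simp add: w_def)
        show "a (n-1) < 0" using n5 by (intro less.IH) auto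
      qed
      ultimately show ?thesis by linarith
    qed
    finally show ?thesis using bpos[of 0] by (simp add: mult_less_0_iff)
  qed (use a in auto)
qed

lemma ln4_bounds: "138629/100000 < ln (4::real)" "ln (4::real) < 13863/10000"
proof -
  have l: "ln (4::real) = 2 * ln 2" using ln_realpow[of 2 2] by simp
  from ln_approx_bounds[of 2 6]
  have "ln (2::real) > 693145/1000000" "ln (2::real) < 69315/100000"
    by (simp_all add: eval_nat_numeral)
  thus "138629/100000 < ln (4::real)" "ln (4::real) < 13863/10000" unfolding l by simp_all
qed

definition ell_AD_fps :: "real fps" where
  "ell_AD_fps = ell_A_fps / ell_D_fps"

text \<open>The \<open>a\<^sub>n\<close> of the introduction, identified with \<open>ell_a\<close> in \<open>ell_a_eq\<close>.\<close>
abbreviation AD_coeff :: "nat \<Rightarrow> real" where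
  "AD_coeff n \<equiv> fps_nth ell_AD_fps n"

lemma ell_D_fps_0: "fps_nth (ell_D_fps :: real fps) 0 = ln 4"
  by (simp add: ell_D_fps_def ell_d_def)

lemma ell_AD_D_fps: "ell_AD_fps * ell_D_fps = ell_A_fps"
proof -
  have nz: "fps_nth (ell_D_fps :: real fps) 0 \<noteq> 0" by (simp add: ell_D_fps_0)
  have "ell_A_fps / ell_D_fps = ell_A_fps * inverse (ell_D_fps :: real fps)"
    by (rule fps_divide_unit[OF nz])
  moreover have "inverse ell_D_fps * ell_D_fps = (1 :: real fps)"
    by (rule inverse_mult_eq_1[OF nz])
  ultimately show ?thesis by (simp add: ell_AD_fps_def mult.assoc)
qed

lemma ell_AD_DA_fps: "ell_AD_fps * ell_DA_fps = 1"
proof -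
  have "(ell_AD_fps * ell_DA_fps) * ell_A_fps = 1 * ell_A_fps"
    by (simp add: mult.assoc ell_DA_A_fps ell_AD_D_fps)
  moreover have "ell_A_fps \<noteq> (0 :: real fps)" using ell_A_fps_0[where ?'a = real] by auto
  ultimately show ?thesis using mult_right_cancel by blast
qed

lemma ell_W_values:
  "ell_W (Suc 0) = 1/2" "ell_W (Suc (Suc 0)) = 3/8" "ell_W (Suc (Suc (Suc 0))) = 5/16"
  "ell_W (Suc (Suc (Suc (Suc 0)))) = 35/128"
  by (simp_all add: ell_W_Suc)

text \<open>The recursion that compares coefficients in \<open>(D/A) A = D\<close>.\<close>
lemma DA_coeff_values:
  "DA_coeff 0 = ln 4" "DA_coeff 1 = 1/2 - ln 4 / 4"
  "DA_coeff 2 = 1/4 - DA_coeff 1 / 4 - 9/64 * ln 4"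
  "DA_coeff 3 = 1/6 - DA_coeff 2 / 4 - 9/64 * DA_coeff 1 - 25/256 * ln 4"
proof -
  have eq: "(\<Sum>i=0..n. DA_coeff i * (ell_W (n - i))\<^sup>2) = ell_d n" for n
    using arg_cong[OF ell_DA_A_fps[where ?'a = real], of "\<lambda>F. fps_nth F n"]
    by (simp add: fps_mult_nth ell_A_fps_def ell_D_fps_def)
  show "DA_coeff 0 = ln 4" using eq[of 0] by (simp add: ell_d_def)
  thus "DA_coeff 1 = 1/2 - ln 4 / 4"
    using eq[of 1] by (simp add: ell_d_def ell_W_values power2_eq_square)
  show "DA_coeff 2 = 1/4 - DA_coeff 1 / 4 - 9/64 * ln 4"
    using eq[of 2] \<open>DA_coeff 0 = ln 4\<close> by (simp add: ell_d_def ell_W_values power2_eq_square eval_nat_numeral)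
  show "DA_coeff 3 = 1/6 - DA_coeff 2 / 4 - 9/64 * DA_coeff 1 - 25/256 * ln 4"
    using eq[of 3] \<open>DA_coeff 0 = ln 4\<close> by (simp add: ell_d_def ell_W_values power2_eq_square eval_nat_numeral)
qed

lemma AD_coeff_values:
  "ln 4 * AD_coeff 0 = 1" "ln 4 * AD_coeff 1 = 1/4 - AD_coeff 0 / 2"
  "ln 4 * AD_coeff 2 = 9/64 - AD_coeff 1 / 2 - AD_coeff 0 / 4"
  "ln 4 * AD_coeff 3 = 25/256 - AD_coeff 2 / 2 - AD_coeff 1 / 4 - AD_coeff 0 / 6"
  "ln 4 * AD_coeff 4 = 1225/16384 - AD_coeff 3 / 2 - AD_coeff 2 / 4 - AD_coeff 1 / 6 - AD_coeff 0 / 8"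
proof -
  have eq: "(\<Sum>i=0..n. AD_coeff i * ell_d (n - i)) = (ell_W n)\<^sup>2" for n
    using arg_cong[OF ell_AD_D_fps, of "\<lambda>F. fps_nth F n"]
    by (simp add: fps_mult_nth ell_A_fps_def ell_D_fps_def)
  show "ln 4 * AD_coeff 0 = 1" "ln 4 * AD_coeff 1 = 1/4 - AD_coeff 0 / 2"
    using eq[of 0] eq[of 1] by (simp_all add: ell_d_def ell_W_values power2_eq_square mult.commute)
  show "ln 4 * AD_coeff 2 = 9/64 - AD_coeff 1 / 2 - AD_coeff 0 / 4"
    using eq[of 2] by (simp add: ell_d_def ell_W_values power2_eq_square eval_nat_numeral mult.commute)
  show "ln 4 * AD_coeff 3 = 25/256 - AD_coeff 2 / 2 - AD_coeff 1 / 4 - AD_coeff 0 / 6"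
    using eq[of 3] by (simp add: ell_d_def ell_W_values power2_eq_square eval_nat_numeral mult.commute)
  show "ln 4 * AD_coeff 4 = 1225/16384 - AD_coeff 3 / 2 - AD_coeff 2 / 4 - AD_coeff 1 / 6 - AD_coeff 0 / 8"
    using eq[of 4] by (simp add: ell_d_def ell_W_values power2_eq_square eval_nat_numeral mult.commute)
qed

lemma DA_coeff_bounds:
  "1534/10000 < DA_coeff 1" "DA_coeff 1 < 1535/10000" "166/10000 < DA_coeff 2" "DA_coeff 2 < 168/10000" "55/10000 < DA_coeff 3"
  using DA_coeff_values ln4_bounds by linarith+

text \<open>The coefficient \<open>a\<^sub>2\<close>, about \<open>0.00015\<close>, is a difference of much larger terms. This is why \<open>ln 4\<close> is needed
to five digits. Each bound for \<open>a\<^sub>k\<close> is a linear inequality in \<open>ln 4\<close> and the preceding coefficients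
once it is multiplied by \<open>ln 4\<close>.\<close>
lemma AD_coeff_initial: "AD_coeff 1 < 0" "AD_coeff 2 \<le> - AD_coeff 3" "AD_coeff 3 < 0" "AD_coeff 4 < 0"
proof -
  have le: "x < q" if "ln 4 * x < q * ln 4" for x q :: real using that by (simp add: mult.commute)
  have ge: "q < x" if "q * ln 4 < ln 4 * x" for x q :: real using that by (simp add: mult.commute)
  note v = AD_coeff_values and L = ln4_bounds
  have a0: "721344/1000000 < AD_coeff 0" "AD_coeff 0 < 721350/1000000"
    by (rule ge, unfold v, use L in simp) (rule le, unfold v, use L in simp)
  have a1: "-7984/100000 < AD_coeff 1" "AD_coeff 1 < -7983/100000"
    by (rule ge, unfold v, use L a0 in simp) (rule le, unfold v, use L a0 in simp)
  have a2: "1/10000 < AD_coeff 2" "AD_coeff 2 < 2/10000"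
    by (rule ge, unfold v, use L a0 a1 in simp) (rule le, unfold v, use L a0 a1 in simp)
  have a3: "-2/1000 < AD_coeff 3" "AD_coeff 3 < -18/10000"
    by (rule ge, unfold v, use L a0 a1 a2 in simp) (rule le, unfold v, use L a0 a1 a2 in simp)
  have a4: "AD_coeff 4 < 0"
    by (rule le, unfold v, use L a0 a1 a2 a3 in simp)
  show "AD_coeff 1 < 0" "AD_coeff 2 \<le> - AD_coeff 3" "AD_coeff 3 < 0" "AD_coeff 4 < 0"
    using a1 a2 a3 a4 by simp_all
qed

text \<open>The quadratic form is nonnegative at its minimum, \<open>\<alpha> = b\<^sub>n\<^sub>+\<^sub>1 / b\<^sub>n\<close>.\<close>
lemma DA_coeff_logconvex:
  assumes n: "n \<ge> 2" and "DA_coeff n > 0"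
  shows "(DA_coeff (n + 1))\<^sup>2 \<le> DA_coeff n * DA_coeff (n + 2)"
proof -
  define \<alpha> where "\<alpha> = DA_coeff (n + 1) / DA_coeff n"
  have "0 \<le> DA_coeff n * (\<alpha>\<^sup>2 * DA_coeff n - 2 * \<alpha> * DA_coeff (n + 1) + DA_coeff (n + 2))"
    using DA_coeff_quadratic_form_nonneg[OF n, of \<alpha>] assms(2) by (intro mult_nonneg_nonneg) auto
  also have "\<dots> = (\<alpha> * DA_coeff n)\<^sup>2 - 2 * (\<alpha> * DA_coeff n) * DA_coeff (n + 1) + DA_coeff n * DA_coeff (n + 2)"
    by (simp add: power2_eq_square algebra_simps)
  also have "\<alpha> * DA_coeff n = DA_coeff (n + 1)" using assms(2) by (simp add: \<alpha>_def)
  finally show ?thesis by (simp add: power2_eq_square)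
qed

text \<open>Log-convexity propagates the positivity of \<open>b\<^sub>2\<close> and \<open>b\<^sub>3\<close>.\<close>
lemma DA_coeff_pos: "DA_coeff n > 0"
proof -
  have "DA_coeff n > 0 \<and> DA_coeff (Suc n) > 0" if "n \<ge> 2" for n
    using that
  proof (induction n rule: dec_induct)
    case base
    show ?case using DA_coeff_bounds by (simp add: eval_nat_numeral)
  next
    case (step n)
    have "0 < (DA_coeff (n + 1))\<^sup>2" using step by simp
    also have "\<dots> \<le> DA_coeff n * DA_coeff (n + 2)" by (rule DA_coeff_logconvex) (use step in auto)
    finally show ?case using step by (simp add: zero_less_mult_iff)
  qed
  moreover have "DA_coeff 0 > 0" "DA_coeff 1 > 0" using DA_coeff_values(1) DA_coeff_bounds(1) by simp_all
  ultimately show ?thesis by (metis One_nat_def Suc_1 le_less_linear less_2_cases)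
qed

lemma AD_coeff_neg:
  assumes "n \<ge> 3"
  shows "AD_coeff n < 0"
proof (rule kaluza_variant[where b = DA_coeff])
  show "(\<Sum>k\<le>n. AD_coeff k * DA_coeff (n - k)) = 0" if "n \<ge> 1" for n
    using arg_cong[OF ell_AD_DA_fps, of "\<lambda>F. fps_nth F n"] that by (simp add: fps_mult_nth atMost_atLeast0)
  show "DA_coeff n > 0" for n by (rule DA_coeff_pos)
  show "DA_coeff (Suc n) \<le> DA_coeff n" if "n \<ge> 1" for n
    using that DA_coeff_decreasing[of n] DA_coeff_bounds by (cases "n = 1") (auto simp: numeral_2_eq_2)
  show "(DA_coeff (n + 1))\<^sup>2 \<le> DA_coeff n * DA_coeff (n + 2)" if "n \<ge> 1" for n
  proof (cases "n = 1")
    case True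
    have "DA_coeff 2 * DA_coeff 2 \<le> 168/10000 * (168/10000)" using DA_coeff_bounds by (intro mult_mono) auto
    also have "\<dots> \<le> 1534/10000 * (55/10000 :: real)" by simp
    also have "\<dots> \<le> DA_coeff 1 * DA_coeff 3" using DA_coeff_bounds by (intro mult_mono) auto
    finally show ?thesis using True by (simp add: power2_eq_square eval_nat_numeral)
  next
    case False
    thus ?thesis using that by (intro DA_coeff_logconvex DA_coeff_pos) auto
  qed
  show "DA_coeff 1 / DA_coeff 0 < DA_coeff 3 / DA_coeff 2"
  proof -
    have "DA_coeff 1 * DA_coeff 2 \<le> 1535/10000 * (168/10000)" using DA_coeff_bounds by (intro mult_mono) auto
    also have "\<dots> < 55/10000 * (138/100 :: real)" by simp
    also have "\<dots> \<le> DA_coeff 3 * DA_coeff 0" unfolding DA_coeff_values(1)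
      using DA_coeff_bounds ln4_bounds by (intro mult_mono) auto
    finally show ?thesis using DA_coeff_pos[of 0] DA_coeff_pos[of 2] by (simp add: field_simps)
  qed
qed (use assms AD_coeff_initial in auto)

section \<open>Power series on the unit interval and absolute monotonicity\<close>

lemma fps_conv_radius_ge_1_bounded:
  fixes F :: "real fps"
  assumes "\<And>n. \<bar>fps_nth F n\<bar> \<le> M"
  shows "fps_conv_radius F \<ge> 1"
  unfolding fps_conv_radius_def
proof (rule conv_radius_geI_ex')
  fix r :: real assume r: "0 < r" "ereal r < 1"
  hence r1: "r < 1" by simp
  show "summable (\<lambda>n. fps_nth F n * of_real r ^ n)"
  proof (rule summable_comparison_test'[of "\<lambda>n. M * r ^ n" 0])
    show "summable (\<lambda>n. M * r ^ n)" using r r1 by (intro summable_mult) auto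
    show "norm (fps_nth F n * of_real r ^ n) \<le> M * r ^ n" for n
      using r assms[of n] by (auto simp: abs_mult intro!: mult_right_mono)
  qed
qed

lemma fps_conv_radius_higher_deriv:
  fixes F :: "real fps"
  assumes "fps_conv_radius F \<ge> 1"
  shows "fps_conv_radius ((fps_deriv ^^ m) F) \<ge> 1"
proof (induction m)
  case (Suc m)
  thus ?case using fps_conv_radius_deriv[of "(fps_deriv ^^ m) F"] by simp
qed (use assms in simp)

lemma norm_less_conv_radius:
  fixes F :: "real fps" and x :: real
  assumes "fps_conv_radius F \<ge> 1" "\<bar>x\<bar> < 1"
  shows "ereal (norm x) < fps_conv_radius F"
proof -
  have "ereal (norm x) < 1" using assms(2) by simp
  thus ?thesis using assms(1) by (rule less_le_trans)
qed

text \<open>Termwise differentiation to all orders, for a function given by a real power series on an open subset of its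
interval of convergence.\<close>
lemma higher_deriv_eq_eval_fps:
  fixes F :: "real fps" and S :: "real set"
  assumes F: "fps_conv_radius F \<ge> 1" and S: "open S" "S \<subseteq> {-1<..<1}"
    and f: "\<And>x. x \<in> S \<Longrightarrow> f x = eval_fps F x" and x: "x \<in> S"
  shows "(deriv ^^ m) f x = eval_fps ((fps_deriv ^^ m) F) x"
    and "((deriv ^^ m) f has_real_derivative eval_fps ((fps_deriv ^^ Suc m) F) x) (at x)"
proof -
  have D: "(eval_fps ((fps_deriv ^^ m) F) has_real_derivative eval_fps ((fps_deriv ^^ Suc m) F) x) (at x)"
    if "x \<in> S" for m x
  proof -
    have "x \<in> {-1<..<1}" using that S by blast
    hence "\<bar>x\<bar> < 1" by auto
    from has_field_derivative_eval_fps[OF norm_less_conv_radius[OF fps_conv_radius_higher_deriv[OF F] this]]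
    show ?thesis by simp
  qed
  have *: "(deriv ^^ m) f x = eval_fps ((fps_deriv ^^ m) F) x" if "x \<in> S" for m x
    using that
  proof (induction m arbitrary: x)
    case (Suc m)
    have "eventually (\<lambda>y. y \<in> S) (nhds x)" using S Suc.prems by (intro eventually_nhds_in_open)
    hence "eventually (\<lambda>y. (deriv ^^ m) f y = eval_fps ((fps_deriv ^^ m) F) y) (nhds x)"
      by eventually_elim (rule Suc.IH)
    hence "deriv ((deriv ^^ m) f) x = deriv (eval_fps ((fps_deriv ^^ m) F)) x"
      by (rule deriv_cong_ev) simp
    thus ?case using D[OF Suc.prems, of m] by (simp add: DERIV_imp_deriv)
  qed (use f in auto)
  show "(deriv ^^ m) f x = eval_fps ((fps_deriv ^^ m) F) x" by (rule *[OF x])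
  show "((deriv ^^ m) f has_real_derivative eval_fps ((fps_deriv ^^ Suc m) F) x) (at x)"
    by (rule has_field_derivative_transform_within_open[OF D[OF x] S(1) x]) (simp add: *)
qed

lemma eval_fps_pos:
  fixes F :: "real fps"
  assumes F: "fps_conv_radius F \<ge> 1" and pos: "\<And>n. fps_nth F n > 0" and x: "0 < x" "x < 1"
  shows "eval_fps F x > 0"
  unfolding eval_fps_def
proof (rule suminf_pos)
  show "summable (\<lambda>n. fps_nth F n * x ^ n)"
    using norm_less_conv_radius[OF F, of x] x by (intro summable_fps) auto
qed (use pos x in auto)

lemma fps_higher_deriv_pos:
  fixes F :: "real fps"
  assumes "\<And>n. fps_nth F n > 0"
  shows "fps_nth ((fps_deriv ^^ m) F) n > 0"
  by (induction m arbitrary: n) (auto simp: assms intro!: mult_pos_pos)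

lemma positive_fps_absolutely_monotonic:
  fixes F :: "real fps"
  assumes F: "fps_conv_radius F \<ge> 1" and pos: "\<And>n. fps_nth F n > 0"
    and h: "\<And>x. x \<in> {0<..<1} \<Longrightarrow> h x = eval_fps F x"
  shows "x \<in> {0<..<1} \<Longrightarrow> (deriv ^^ m) h x > 0"
    and "absolutely_monotonic_on {0<..<1} h"
proof -
  have S: "open {0<..<1::real}" "{0<..<1::real} \<subseteq> {-1<..<1}" by auto
  note D = higher_deriv_eq_eval_fps[OF F S h]
  have P: "(deriv ^^ m) h x > 0" if x: "x \<in> {0<..<1}" for m x
    unfolding D(1)[OF _ x, simplified]
    by (rule eval_fps_pos[OF fps_conv_radius_higher_deriv[OF F] fps_higher_deriv_pos[OF pos]]) (use x in auto)
  show "x \<in> {0<..<1} \<Longrightarrow> (deriv ^^ m) h x > 0" by (rule P)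
  show "absolutely_monotonic_on {0<..<1} h"
    unfolding absolutely_monotonic_on_def
  proof (intro conjI exI[of _ "\<lambda>m. (deriv ^^ m) h"] allI ballI)
    fix m x assume x: "x \<in> {0<..<1::real}"
    have "((deriv ^^ m) h has_real_derivative (deriv ^^ Suc m) h x) (at x)"
      using D(2)[OF _ x, of m] D(1)[OF _ x, of "Suc m"] by simp
    thus "((deriv ^^ m) h has_real_derivative (deriv ^^ Suc m) h x) (at x within {0<..<1})"
      by (rule has_field_derivative_at_within)
    show "0 \<le> (deriv ^^ m) h x" using P[OF x] by (simp add: less_imp_le)
  qed (auto simp: is_interval_oo)
qed

lemma ell_A_pos: "\<bar>x\<bar> < 1 \<Longrightarrow> ell_A (x::real) > 0"
proof -
  assume x: "\<bar>x\<bar> < 1"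
  have "1 / sqrt 2 \<le> Re (ell_A (of_real x))" by (rule Re_ell_A_ge) (use x in auto)
  moreover have "1 / sqrt 2 > (0::real)" by simp
  ultimately show ?thesis using ell_A_of_real[OF x] by (metis Re_complex_of_real less_le_trans)
qed

lemma eval_ell_A_fps: "eval_fps ell_A_fps x = ell_A (x::real)"
  by (simp add: eval_fps_def ell_A_def ell_A_fps_def)

lemma ell_K_sqrt_eq_ell_A: "ell_K_sqrt x = pi / 2 * ell_A x"
  by (simp add: ell_K_sqrt_def ell_A_def)

lemma eval_ell_D_fps:
  assumes x: "\<bar>x\<bar> < 1"
  shows "eval_fps ell_D_fps x = ln 4 - ln (sqrt (1 - x))"
proof -
  have "(\<lambda>n. - ((- (- x)) ^ n) / of_nat n) sums ln (1 + (-x))"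
    by (rule ln_series') (use x in auto)
  from sums_mult[OF this, of "-1/2"]
  have "(\<lambda>n. 1 / (2 * real n) * x ^ n) sums (- ln (1 - x) / 2)" by simp
  moreover have "(\<lambda>n. if n = 0 then ln 4 else 0) sums (ln 4 :: real)"
    using sums_single[of 0 "\<lambda>_. ln 4 :: real"] by simp
  ultimately have "(\<lambda>n. 1 / (2 * real n) * x ^ n + (if n = 0 then ln 4 else 0)) sums (- ln (1 - x) / 2 + ln 4)"
    by (rule sums_add)
  moreover have "1 / (2 * real n) * x ^ n + (if n = 0 then ln 4 else 0) = fps_nth ell_D_fps n * x ^ n" for n
    by (simp add: ell_d_def ell_D_fps_def)
  ultimately show ?thesis using x by (simp add: eval_fps_def sums_iff ln_sqrt)
qed

lemma ell_D_real_pos: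
  assumes x: "\<bar>x\<bar> < 1"
  shows "ln 4 - ln (sqrt (1 - x)) > 0"
proof -
  have "sqrt (1 - x) < sqrt 16" using x by (intro real_sqrt_less_mono) auto
  also have "sqrt 16 = (4::real)" by (rule real_sqrt_unique) auto
  finally show ?thesis using x by (simp add: ln_less_cancel_iff)
qed

lemma ell_d_bounds: "0 \<le> ell_d n" "ell_d n \<le> 2"
  using ln4_bounds by (auto simp: ell_d_def field_simps)

text \<open>All four coefficient sequences are bounded. For \<open>A/D\<close> the sign information helps: in
\<open>\<Sum>k\<le>n. a\<^sub>k d\<^sub>n\<^sub>-\<^sub>k = W\<^sub>n\<^sup>2 \<ge> 0\<close> the negative terms are dominated by the three terms with \<open>k < 3\<close>, which
are bounded.\<close>
lemma ell_conv_radius: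
  "fps_conv_radius (ell_A_fps :: real fps) \<ge> 1" "fps_conv_radius (ell_D_fps :: real fps) \<ge> 1"
  "fps_conv_radius (ell_DA_fps :: real fps) \<ge> 1" "fps_conv_radius ell_AD_fps \<ge> 1"
proof -
  show "fps_conv_radius (ell_A_fps :: real fps) \<ge> 1"
    by (rule fps_conv_radius_ge_1_bounded[of _ 1]) (simp add: ell_A_fps_def ell_W_sq_le_1)
  show "fps_conv_radius (ell_D_fps :: real fps) \<ge> 1"
    by (rule fps_conv_radius_ge_1_bounded[of _ 2]) (simp add: ell_D_fps_def ell_d_bounds)
  show "fps_conv_radius (ell_DA_fps :: real fps) \<ge> 1"
  proof (rule fps_conv_radius_ge_1_bounded[of _ 2])
    fix n
    have "DA_coeff n \<le> 1" if "n \<ge> 2"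
      using that
    proof (induction n rule: dec_induct)
      case base show ?case using DA_coeff_bounds by simp
    next
      case (step n) thus ?case using DA_coeff_decreasing[of n] by linarith
    qed
    moreover have "DA_coeff 0 \<le> 2" "DA_coeff 1 \<le> 1" using DA_coeff_values(1) DA_coeff_bounds ln4_bounds by auto
    ultimately have "DA_coeff n \<le> 2" using less_2_cases[of n] by (cases "n \<ge> 2") auto
    thus "\<bar>DA_coeff n\<bar> \<le> 2" using DA_coeff_pos[of n] by simp
  qed
  show "fps_conv_radius ell_AD_fps \<ge> 1"
  proof (rule fps_conv_radius_ge_1_bounded)
    fix n
    show "\<bar>AD_coeff n\<bar> \<le> 2 * (\<Sum>k<3. \<bar>AD_coeff k\<bar>)"
    proof (cases "n < 3")
      case True
      have "\<bar>AD_coeff n\<bar> \<le> (\<Sum>k<3. \<bar>AD_coeff k\<bar>)"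
        using True by (intro member_le_sum) auto
      thus ?thesis using abs_ge_zero[of "AD_coeff n"] by linarith
    next
      case False
      have "(\<Sum>k\<le>n. AD_coeff k * ell_d (n - k)) = (ell_W n)\<^sup>2"
        using arg_cong[OF ell_AD_D_fps, of "\<lambda>F. fps_nth F n"]
        by (simp add: fps_mult_nth ell_A_fps_def ell_D_fps_def atMost_atLeast0)
      moreover have "{..n} = {..<3} \<union> {3..<n} \<union> {n}" using False by auto
      moreover have "{..<3} \<inter> {3..<n} = {}" by auto
      ultimately have "(\<Sum>k<3. AD_coeff k * ell_d (n - k)) + (\<Sum>k=3..<n. AD_coeff k * ell_d (n - k)) + AD_coeff n * ln 4 = (ell_W n)\<^sup>2"
        using False by (simp add: sum.union_disjoint ell_d_def[of 0])
      moreover have "(\<Sum>k=3..<n. AD_coeff k * ell_d (n - k)) \<le> 0"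
        by (intro sum_nonpos mult_nonpos_nonneg ell_d_bounds) (auto intro: less_imp_le AD_coeff_neg)
      moreover have "(\<Sum>k<3. AD_coeff k * ell_d (n - k)) \<le> (\<Sum>k<3. \<bar>AD_coeff k\<bar> * 2)"
        using ell_d_bounds by (intro sum_mono mult_mono) auto
      moreover have "\<dots> = 2 * (\<Sum>k<3. \<bar>AD_coeff k\<bar>)" by (simp add: sum_distrib_left mult.commute)
      moreover have "- AD_coeff n \<le> - (AD_coeff n * ln 4)"
        using AD_coeff_neg[of n] False ln4_bounds mult_left_mono_neg[of 1 "ln 4" "AD_coeff n"] by auto
      moreover have "(ell_W n)\<^sup>2 \<ge> 0" by simp
      moreover have "\<bar>AD_coeff n\<bar> = - AD_coeff n" using AD_coeff_neg[of n] False by simp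
      ultimately show ?thesis by linarith
    qed
  qed
qed

definition ell_f_fps :: "real fps" where "ell_f_fps = fps_const (pi/2) * ell_AD_fps"
definition ell_g_fps :: "real fps" where "ell_g_fps = fps_const (2/pi) * ell_DA_fps"

lemma ell_fg_conv_radius: "fps_conv_radius ell_f_fps \<ge> 1" "fps_conv_radius ell_g_fps \<ge> 1"
  using ell_conv_radius by (simp_all add: ell_f_fps_def ell_g_fps_def fps_conv_radius_cmult_left)

lemma eval_ell_fg:
  assumes x: "\<bar>x\<bar> < 1"
  shows "eval_fps ell_f_fps x = ell_f_an (ln 4) x" "eval_fps ell_g_fps x = ell_g_an (ln 4) x"
proof -
  note r = ell_conv_radius[THEN norm_less_conv_radius, OF x]
  have D0: "ln 4 - ln (sqrt (1 - x)) \<noteq> 0" using ell_D_real_pos[OF x] by simp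
  have A0: "ell_A x \<noteq> 0" using ell_A_pos[OF x] by simp
  have "eval_fps (ell_AD_fps * ell_D_fps) x = eval_fps ell_AD_fps x * eval_fps ell_D_fps x"
    by (rule eval_fps_mult) (fact r)+
  hence a: "eval_fps ell_AD_fps x = ell_A x / (ln 4 - ln (sqrt (1 - x)))"
    unfolding ell_AD_D_fps eval_ell_A_fps eval_ell_D_fps[OF x] nonzero_eq_divide_eq[OF D0] by (rule sym)
  have "eval_fps (ell_DA_fps * ell_A_fps) x = eval_fps ell_DA_fps x * eval_fps ell_A_fps x"
    by (rule eval_fps_mult) (fact r)+
  hence b: "eval_fps ell_DA_fps x = (ln 4 - ln (sqrt (1 - x))) / ell_A x"
    unfolding ell_DA_A_fps eval_ell_A_fps eval_ell_D_fps[OF x] nonzero_eq_divide_eq[OF A0] by (rule sym)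
  have c: "eval_fps (fps_const c * F) x = c * eval_fps F x" if "ereal (norm x) < fps_conv_radius F" for c and F :: "real fps"
    using that by (subst eval_fps_mult) auto
  show "eval_fps ell_f_fps x = ell_f_an (ln 4) x"
    by (simp add: ell_f_fps_def c[OF r(4)] a ell_f_an_def ell_K_sqrt_eq_ell_A)
  show "eval_fps ell_g_fps x = ell_g_an (ln 4) x"
    by (simp add: ell_g_fps_def c[OF r(3)] b ell_g_an_def ell_K_sqrt_eq_ell_A)
qed

lemma fps_higher_deriv_nth_0: "fps_nth ((fps_deriv ^^ n) F) 0 = fact n * fps_nth (F :: real fps) n"
  by (induction n arbitrary: F) (simp_all add: funpow_Suc_right del: funpow.simps)

lemma has_fps_expansion_unit_disc:
  fixes F :: "real fps"
  assumes F: "fps_conv_radius F \<ge> 1" and f: "\<And>x. \<bar>x\<bar> < 1 \<Longrightarrow> eval_fps F x = f x"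
  shows "f has_fps_expansion F" "(deriv ^^ n) f 0 / fact n = fps_nth F n"
proof -
  have "0 < fps_conv_radius F" using F by (rule less_le_trans[rotated]) simp
  moreover have "eventually (\<lambda>x::real. x \<in> {-1<..<1}) (nhds 0)" by (intro eventually_nhds_in_open) auto
  hence "eventually (\<lambda>x. eval_fps F x = f x) (nhds 0)"
    by eventually_elim (use f in auto)
  ultimately show "f has_fps_expansion F" by (simp add: has_fps_expansion_def)
  have "(deriv ^^ n) f 0 = eval_fps ((fps_deriv ^^ n) F) 0"
    by (rule higher_deriv_eq_eval_fps(1)[OF F, of "{-1<..<1}"]) (use f in auto)
  thus "(deriv ^^ n) f 0 / fact n = fps_nth F n"
    by (simp add: eval_fps_at_0 fps_higher_deriv_nth_0)
qed

lemma ell_a_eq: "ell_a (ln 4) n = AD_coeff n"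
  using has_fps_expansion_unit_disc(2)[OF ell_fg_conv_radius(1) eval_ell_fg(1), of n]
  by (simp add: ell_a_def ell_f_fps_def field_simps)

lemma ell_b_eq: "ell_b (ln 4) n = DA_coeff n"
  using has_fps_expansion_unit_disc(2)[OF ell_fg_conv_radius(2) eval_ell_fg(2), of n]
  by (simp add: ell_b_def ell_g_fps_def field_simps)

lemma ell_fg_eq:
  assumes x: "x \<in> {0<..<1}"
  shows "ell_f (ln 4) x = eval_fps ell_f_fps x" "ell_g (ln 4) x = eval_fps ell_g_fps x"
proof -
  have "ell_K (sqrt x) = ell_K_sqrt x" using ell_K_sqrt_eq[of x] x by (simp add: ell_K_sqrt_eq_ell_A)
  moreover have "\<bar>x\<bar> < 1" using x by auto
  ultimately show "ell_f (ln 4) x = eval_fps ell_f_fps x" "ell_g (ln 4) x = eval_fps ell_g_fps x"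
    using eval_ell_fg[of x] by (simp_all add: ell_f_def ell_f_an_def ell_g_def ell_g_an_def)
qed

theorem theorem1p1:
  shows "(\<forall>x\<in>{0<..<1}. (\<lambda>n. pi/2 * ((ell_W n)\<^sup>2 * x ^ n)) sums ell_K (sqrt x))
    \<and> ell_f_an (ln 4) has_fps_expansion (fps_const (pi/2) * Abs_fps (ell_a (ln 4)))
    \<and> ell_g_an (ln 4) has_fps_expansion (fps_const (2/pi) * Abs_fps (ell_b (ln 4)))
    \<and> (\<forall>n\<ge>3. ell_a (ln 4) n < 0)
    \<and> (\<forall>n. ell_b (ln 4) n > 0)
    \<and> (\<forall>m. \<forall>x\<in>{0<..<1}.
          (deriv ^^ m) (ell_f (ln 4)) differentiable (at x)
        \<and> (deriv ^^ m) (ell_g (ln 4)) differentiable (at x)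
        \<and> (deriv ^^ m) (\<lambda>y. - (deriv ^^ 3) (ell_f (ln 4)) y) x > 0
        \<and> (deriv ^^ m) (ell_g (ln 4)) x > 0)
    \<and> absolutely_monotonic_on {0<..<1} (\<lambda>y. - (deriv ^^ 3) (ell_f (ln 4)) y)
    \<and> absolutely_monotonic_on {0<..<1} (ell_g (ln 4))"
proof -
  have S: "open {0<..<1::real}" "{0<..<1::real} \<subseteq> {-1<..<1}" by auto
  have 1: "(\<lambda>n. pi/2 * ((ell_W n)\<^sup>2 * x ^ n)) sums ell_K (sqrt x)" if "x \<in> {0<..<1}" for x
  proof -
    have "(\<lambda>n. pi/2 * (of_real ((ell_W n)\<^sup>2) * x ^ n)) sums (pi/2 * ell_A x)"
      by (intro sums_mult ell_A_sums) (use that in auto)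
    moreover have "ell_K (sqrt x) = pi/2 * ell_A x" using ell_K_sqrt_eq[of x] that by simp
    ultimately show ?thesis by (simp only: of_real_eq_id id_apply)
  qed
  have "Abs_fps (ell_a (ln 4)) = ell_AD_fps" "Abs_fps (ell_b (ln 4)) = ell_DA_fps"
    by (simp_all add: fps_eq_iff ell_a_eq ell_b_eq)
  hence 2: "ell_f_an (ln 4) has_fps_expansion (fps_const (pi/2) * Abs_fps (ell_a (ln 4)))"
    "ell_g_an (ln 4) has_fps_expansion (fps_const (2/pi) * Abs_fps (ell_b (ln 4)))"
    using has_fps_expansion_unit_disc(1)[OF ell_fg_conv_radius(1) eval_ell_fg(1)]
      has_fps_expansion_unit_disc(1)[OF ell_fg_conv_radius(2) eval_ell_fg(2)]
    by (simp_all add: ell_f_fps_def ell_g_fps_def)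
  note Df = higher_deriv_eq_eval_fps[OF ell_fg_conv_radius(1) S ell_fg_eq(1)]
  note Dg = higher_deriv_eq_eval_fps[OF ell_fg_conv_radius(2) S ell_fg_eq(2)]
  have g_pos: "fps_nth ell_g_fps n > 0" for n by (simp add: ell_g_fps_def DA_coeff_pos)
  define P where "P = - (fps_deriv ^^ 3) ell_f_fps"
  have P_radius: "fps_conv_radius P \<ge> 1"
    unfolding P_def using fps_conv_radius_higher_deriv[OF ell_fg_conv_radius(1)] by simp
  have P_pos: "fps_nth P n > 0" for n
    using AD_coeff_neg[of "n + 3"]
    by (simp add: P_def ell_f_fps_def numeral_3_eq_3 mult_pos_neg)
  have P_eq: "- (deriv ^^ 3) (ell_f (ln 4)) x = eval_fps P x" if x: "x \<in> {0<..<1}" for x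
  proof -
    have "ereal (norm x) < fps_conv_radius ((fps_deriv ^^ 3) ell_f_fps)"
      by (rule norm_less_conv_radius[OF fps_conv_radius_higher_deriv[OF ell_fg_conv_radius(1)]]) (use x in auto)
    thus ?thesis unfolding P_def using Df(1)[OF _ x, of 3] by (simp add: eval_fps_minus)
  qed
  note f_mono = positive_fps_absolutely_monotonic[OF P_radius P_pos P_eq]
  note g_mono = positive_fps_absolutely_monotonic[OF ell_fg_conv_radius(2) g_pos ell_fg_eq(2)]
  have "(deriv ^^ m) (ell_f (ln 4)) differentiable (at x)" "(deriv ^^ m) (ell_g (ln 4)) differentiable (at x)"
    if "x \<in> {0<..<1}" for m x
    using Df(2)[OF _ that] Dg(2)[OF _ that] real_differentiable_def by blast+
  thus ?thesis using 1 2 AD_coeff_neg DA_coeff_pos f_mono g_mono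
    by (auto simp: ell_a_eq ell_b_eq)
qed

end
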